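(* Let $X$ be a Banach space and let $\{T_\eta\}_{\eta\in[0,1]}$ be a family of maps in $C(X)$. Suppose that (a) there exists $p\in\mathbb N$ such that each $T_\eta$ has a family $\mathcal E_\eta=\{x^\ast_{1,\eta},\ldots,x^\ast_{p,\eta}\}$ of $\mathfrak L$-hyperbolic equilibria; (b) $\|x^\ast_{i,\eta}-x^\ast_{i,0}\|\to0$ as $\eta\to0^+$, for $i=1,\ldots,p$; (c) there exists a neighborhood $U$ of $\mathcal E_0$ such that $|\!|\!|T_\eta-T_0|\!|\!|_U\to0$ as $\eta\to0^+$ and $T_\eta\colon U\to T_\eta(U)$ is bi-Lipschitz for each $\eta\in[0,1]$; (d) $T_0\in C^{1+}(X)$. Then for each $n\in\mathbb N$ and $i=1,\ldots,p$, the families $\{T_\eta^nW^{\rm u,\eta}_{loc}(x^\ast_{i,\eta})\}_{\eta\in[0,1]}$ and $\{W^{\rm s,\eta}_{loc}(x^\ast_{i,\eta})\}_{\eta\in[0,1]}$ are continuous at $\eta=0$, with convergence in the norm $|\!|\!|\cdot|\!|\!|$.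
   Context: $C(X)$ is the set of continuous maps $X\to X$; an equilibrium point of $T$ is $x$ with $T(x)=x$. A map is bi-Lipschitz if it is invertible and it and its inverse are Lipschitz. For a map $T$ defined on a set $V$ in a Banach space: $\|T\|_{V,Lip}=\sup_{x\ne y\in V}\frac{\|T(x)-T(y)\|}{\|x-y\|}$, $\|T\|_{V,\infty}=\sup_{x\in V}\|T(x)\|$, $|\!|\!|T|\!|\!|_V=\max\{\|T\|_{V,\infty},\|T\|_{V,Lip}\}$. $T_0\in C^{1+}(X)$ means that $T_0$ is differentiable in $X$ with derivative uniformly continuous in a neighborhood of the equilibrium points under consideration. Weakly hyperbolic points. Let $L$ be a bounded linear operator on $X$ with $\sigma(L)\cap\{|\lambda|=1\}=\varnothing$. Put $\pi_s=\frac1{2\pi i}\int_{|\lambda|=1}(\lambda-L)^{-1}d\lambda$, $\pi_u=I-\pi_s$, $X_j=\pi_jX$, $L_j=L|_{X_j}$ ($j=u,s$). One has $0<b<1<a$ with $\sigma(L_s)\subset\{|\lambda|<b\}$, $\sigma(L_u)\subset\{|\lambda|>a\}$, and $X$ is equipped with an equivalent norm satisfying $\|L_s\|\leqslant b$, $\|L_u^{-1}\|\leqslant a^{-1}$, $\|x_u+x_s\|=\max\{\|x_u\|,\|x_s\|\}$. An equilibrium point $x^\ast$ of $T$ is weakly hyperbolic if $S(x)=T(x+x^\ast)-x^\ast$ has a decomposition $S=L+N$ with: (i) $L,a,b$ and the norm as just described; (ii) there are a neighborhood $U_0$ of $0$ and $\gamma={\rm Lip}(N)>0$ with $b+2\gamma<1<a-2\gamma$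 and $\|N(x)-N(y)\|\leqslant\gamma\|x-y\|$ on $U_0$; (iii) $0<\gamma\|(I-L)^{-1}\|\leqslant1$. Local manifolds. For a weakly hyperbolic point $x^\ast$ of $T$, $W^{\rm s}_{loc}(x^\ast)$ and $W^{\rm u}_{loc}(x^\ast)$ denote the local stable and unstable manifolds: for suitable $\epsilon_0>0$ and neighborhoods $O'$ of $x^\ast$ and $V_u,V_s$ of $0$ in $X_u,X_s$, they are graphs of Lipschitz maps over $x^\ast+V_s$ and $x^\ast+V_u$ respectively, and $W^{\rm s}_{loc}(x^\ast)=\{x\in O': T^nx\in O'\ \forall n\geqslant0,\ \|T^nx-x^\ast\|=o((1-\epsilon_0)^n)\}$, $W^{\rm u}_{loc}(x^\ast)=\{x\in O':\exists\{x_j\}_{j\leqslant0}\subset O',\ x_0=x,\ x_{j+1}=T(x_j),\ \sup_{j\leqslant0}(1+\epsilon_0)^{-j}\|x_j-x^\ast\|<\infty\}$. The superscript $\eta$ means that the manifold is taken for $T_\eta$. $\mathfrak L$-hyperbolic points. A weakly hyperbolic point $x^\ast$ of $T$, with decomposition $S=L+N$, is $\mathfrak L$-hyperbolic if ${\rm Lip}(N)<\gamma_1$, where $\gamma_1=\gamma_1(L)>0$ is a constant (whose existence the paper proves) with the following property: if $R\in C(X)$ has $0$ as a weakly hyperbolic point with decomposition $R=L+N$ and ${\rm Lip}(N)<\gamma_1$, then there are neighborhoods $O,V_u,V_s$ of $0$ in $X,X_u,X_s$ and a bi-Lipschitz map $g\colon X\to X$ with $g(0)=0$ such that $0$ is a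 weakly hyperbolic point of $R_1=g^{-1}\circ R\circ g$ with decomposition $R_1=L+N_1$, and the local manifolds of $0$ for $R_1$ satisfy $W^{\rm u,1}_{loc}(0)\cap O=V_u$, $W^{\rm s,1}_{loc}(0)\cap O=V_s$; in particular $\pi_uN_1(x_s)=0=\pi_sN_1(x_u)$ for $x_u\in V_u$, $x_s\in V_s$. Meaning of the conclusion. Let $X=X_u\oplus X_s$ be the decomposition associated with $x^\ast_{i,0}$. Continuity at $\eta=0$ of the stable family means that there are a neighborhood $V_s$ of $0$ in $X_s$ and Lipschitz maps $\sigma_\eta\colon V_s\to X_u$ (for small $\eta$) with $W^{\rm s,\eta}_{loc}(x^\ast_{i,\eta})=\{x^\ast_{i,\eta}+\sigma_\eta(\mu)+\mu:\mu\in V_s\}$ and $|\!|\!|\sigma_\eta-\sigma_0|\!|\!|_{V_s}\to0$ as $\eta\to0^+$. Continuity at $\eta=0$ of the unstable family means that there are a neighborhood $V_u$ of $0$ in $X_u$ and Lipschitz maps $\theta_\eta\colon V_u\to X_s$ with $W^{\rm u,\eta}_{loc}(x^\ast_{i,\eta})=\{x^\ast_{i,\eta}+\xi+\theta_\eta(\xi):\xi\in V_u\}$, $|\!|\!|\theta_\eta-\theta_0|\!|\!|_{V_u}\to0$, and such that the parametrizations $\psi_\eta(\xi)=T_\eta^n(x^\ast_{i,\eta}+\xi+\theta_\eta(\xi))$ of $T_\eta^nW^{\rm u,\eta}_{loc}(x^\ast_{i,\eta})$ satisfy $|\!|\!|\psi_\eta-\psi_0|\!|\!|_{V_u}\to0$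 as $\eta\to0^+$. *)

theory Defs
  imports "HOL-Analysis.Analysis" "HOL-Library.Landau_Symbols"
begin

text \<open>Neighbourhoods are taken open throughout (relatively open in a subspace).

  The norms below are extended-valued, so that an unbounded or non-Lipschitz map has norm \<open>\<infinity>\<close>
  (a real-valued supremum would be an unspecified number there).\<close>

definition sup_norm_on :: "'a set \<Rightarrow> ('a \<Rightarrow> 'b::real_normed_vector) \<Rightarrow> ennreal" where
  "sup_norm_on V f = (SUP x\<in>V. ennreal (norm (f x)))"

definition lip_seminorm_on ::
    "'a::real_normed_vector set \<Rightarrow> ('a \<Rightarrow> 'b::real_normed_vector) \<Rightarrow> ennreal" where
  "lip_seminorm_on V f =
     (SUP (x, y)\<in>{(x, y). x \<in> V \<and> y \<in> V \<and> x \<noteq> y}. ennreal (norm (f x - f y) / norm (x - y)))"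

definition lip_norm_on ::
    "'a::real_normed_vector set \<Rightarrow> ('a \<Rightarrow> 'b::real_normed_vector) \<Rightarrow> ennreal" where
  "lip_norm_on V f = max (sup_norm_on V f) (lip_seminorm_on V f)"

definition bi_lipschitz :: "'a::metric_space set \<Rightarrow> 'b::metric_space set \<Rightarrow> ('a \<Rightarrow> 'b) \<Rightarrow> bool" where
  "bi_lipschitz A B f \<longleftrightarrow>
     bij_betw f A B \<and> (\<exists>C. C-lipschitz_on A f) \<and> (\<exists>C. C-lipschitz_on B (inv_into A f))"

text \<open>Differentiable on the whole space, with derivative uniformly continuous on a neighbourhood of
  the set \<open>E\<close> of equilibria under consideration.\<close>

definition C1_plus :: "('a::real_normed_vector \<Rightarrow> 'a) \<Rightarrow> 'a set \<Rightarrow> bool" where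
  "C1_plus T E \<longleftrightarrow>
     (\<exists>D. (\<forall>x. (T has_derivative blinfun_apply (D x)) (at x)) \<and>
          (\<exists>W. open W \<and> E \<subseteq> W \<and> uniformly_continuous_on W D))"

text \<open>The Banach space is real, so spectra are those of the complexified operator. A pair \<open>(x, y)\<close>
  stands for \<open>x + \<i> y\<close>; the product norm is equivalent to any norm turning the complexification
  into a complex Banach space, and only its topology matters here.\<close>

definition cscale :: "complex \<Rightarrow> 'a::real_vector \<times> 'a \<Rightarrow> 'a \<times> 'a" where
  "cscale l z = (Re l *\<^sub>R fst z - Im l *\<^sub>R snd z, Im l *\<^sub>R fst z + Re l *\<^sub>R snd z)"

definition shifted :: "complex \<Rightarrow> ('a::real_normed_vector \<Rightarrow>\<^sub>L 'a) \<Rightarrow> 'a \<times> 'a \<Rightarrow> 'a \<times> 'a" where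
  "shifted l L z = cscale l z - (blinfun_apply L (fst z), blinfun_apply L (snd z))"

text \<open>The spectrum of the restriction of \<open>L\<close> to a subspace \<open>V\<close>, whose complexification
  is \<open>V \<times> V\<close>: the \<open>l\<close> for which \<open>l - L\<close> has no bounded inverse there.\<close>

definition spectrum_on :: "'a::real_normed_vector set \<Rightarrow> ('a \<Rightarrow>\<^sub>L 'a) \<Rightarrow> complex set" where
  "spectrum_on V L =
     {l. \<not> (bij_betw (shifted l L) (V \<times> V) (V \<times> V) \<and>
            (\<exists>K. \<forall>z\<in>V \<times> V. norm (inv_into (V \<times> V) (shifted l L) z) \<le> K * norm z))}"

text \<open>With \<open>l = exp (\<i> t)\<close>, the contour integral \<open>1/(2 \<pi> \<i>) \<integral> (l - L)\<^sup>-\<^sup>1 dl\<close> over the unit circle is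
  \<open>1/(2 \<pi>) \<integral> exp (\<i> t) (exp (\<i> t) - L)\<^sup>-\<^sup>1 dt\<close> over \<open>[0, 2 \<pi>]\<close>, an integral of bounded operators on
  the complexification. The contour is invariant under conjugation, so its value maps
  \<open>(x, 0)\<close> to some \<open>(y, 0)\<close>.\<close>

definition proj_s :: "('a::banach \<Rightarrow>\<^sub>L 'a) \<Rightarrow> 'a \<Rightarrow> 'a" where
  "proj_s L x =
     fst (blinfun_apply
       ((1 / (2 * pi)) *\<^sub>R
          integral {0..2 * pi} (\<lambda>t. Blinfun (\<lambda>z. cscale (cis t) (inv (shifted (cis t) L) z))))
       (x, 0))"

definition proj_u :: "('a::banach \<Rightarrow>\<^sub>L 'a) \<Rightarrow> 'a \<Rightarrow> 'a" where
  "proj_u L x = x - proj_s L x"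

definition space_s :: "('a::banach \<Rightarrow>\<^sub>L 'a) \<Rightarrow> 'a set" where
  "space_s L = range (proj_s L)"

definition space_u :: "('a::banach \<Rightarrow>\<^sub>L 'a) \<Rightarrow> 'a set" where
  "space_u L = range (proj_u L)"

definition equivalent_norm :: "('a::real_normed_vector \<Rightarrow> real) \<Rightarrow> bool" where
  "equivalent_norm nrm \<longleftrightarrow>
     (\<forall>x y. nrm (x + y) \<le> nrm x + nrm y) \<and> (\<forall>c x. nrm (c *\<^sub>R x) = \<bar>c\<bar> * nrm x) \<and>
     (\<exists>c>0. \<exists>C. \<forall>x. c * norm x \<le> nrm x \<and> nrm x \<le> C * norm x)"

text \<open>As for \<^const>\<open>onorm\<close>, division by zero makes the value \<open>0\<close> on the trivial subspace.\<close>

definition op_norm_on :: "('a \<Rightarrow> real) \<Rightarrow> 'a set \<Rightarrow> ('a \<Rightarrow> 'a) \<Rightarrow> real" where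
  "op_norm_on nrm V f = (SUP x\<in>V. nrm (f x) / nrm x)"

definition hyperbolic_operator ::
    "('a::banach \<Rightarrow>\<^sub>L 'a) \<Rightarrow> real \<Rightarrow> real \<Rightarrow> ('a \<Rightarrow> real) \<Rightarrow> bool" where
  "hyperbolic_operator L a b nrm \<longleftrightarrow>
     spectrum_on UNIV L \<inter> {l. cmod l = 1} = {} \<and>
     0 < b \<and> b < 1 \<and> 1 < a \<and>
     spectrum_on (space_s L) L \<subseteq> {l. cmod l < b} \<and>
     spectrum_on (space_u L) L \<subseteq> {l. cmod l > a} \<and>
     equivalent_norm nrm \<and>
     op_norm_on nrm (space_s L) (blinfun_apply L) \<le> b \<and>
     op_norm_on nrm (space_u L) (inv_into (space_u L) (blinfun_apply L)) \<le> inverse a \<and>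
     (\<forall>v\<in>space_u L. \<forall>w\<in>space_s L. nrm (v + w) = max (nrm v) (nrm w))"

text \<open>\<open>x0\<close> is a weakly hyperbolic equilibrium of \<open>T\<close>, with decomposition
  \<open>T (x + x0) - x0 = L x + N x\<close> and Lipschitz constant \<open>g\<close> for \<open>N\<close> near \<open>0\<close>.
  Lipschitz constant and operator norm refer to the adapted norm \<open>nrm\<close>.\<close>

definition weakly_hyperbolic_with ::
    "('a::banach \<Rightarrow> 'a) \<Rightarrow> 'a \<Rightarrow> ('a \<Rightarrow>\<^sub>L 'a) \<Rightarrow> ('a \<Rightarrow> 'a) \<Rightarrow> real \<Rightarrow> real \<Rightarrow> ('a \<Rightarrow> real) \<Rightarrow> real
       \<Rightarrow> bool" where
  "weakly_hyperbolic_with T x0 L N a b nrm g \<longleftrightarrow>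
     T x0 = x0 \<and>
     (\<forall>x. T (x + x0) - x0 = blinfun_apply L x + N x) \<and>
     hyperbolic_operator L a b nrm \<and>
     0 < g \<and> b + 2 * g < 1 \<and> 1 < a - 2 * g \<and>
     (\<exists>U0. open U0 \<and> 0 \<in> U0 \<and> (\<forall>x\<in>U0. \<forall>y\<in>U0. nrm (N x - N y) \<le> g * nrm (x - y))) \<and>
     0 < g * op_norm_on nrm UNIV (inv (\<lambda>x. x - blinfun_apply L x)) \<and>
     g * op_norm_on nrm UNIV (inv (\<lambda>x. x - blinfun_apply L x)) \<le> 1"

definition local_stable :: "('a::real_normed_vector \<Rightarrow> 'a) \<Rightarrow> 'a \<Rightarrow> real \<Rightarrow> 'a set \<Rightarrow> 'a set" where
  "local_stable T x0 e Ob =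
     {x \<in> Ob. (\<forall>n. (T ^^ n) x \<in> Ob) \<and> (\<lambda>n. norm ((T ^^ n) x - x0)) \<in> o(\<lambda>n. (1 - e) ^ n)}"

text \<open>The backward orbit is indexed by naturals: \<open>y j\<close> is the point at time \<open>-j\<close>.\<close>

definition local_unstable :: "('a::real_normed_vector \<Rightarrow> 'a) \<Rightarrow> 'a \<Rightarrow> real \<Rightarrow> 'a set \<Rightarrow> 'a set" where
  "local_unstable T x0 e Ob =
     {x \<in> Ob. \<exists>y. y 0 = x \<and> (\<forall>j. y j \<in> Ob \<and> y j = T (y (Suc j))) \<and>
                  bdd_above (range (\<lambda>j::nat. (1 + e) ^ j * norm (y j - x0)))}"

definition local_data :: "'a::topological_space \<Rightarrow> real \<Rightarrow> 'a set \<Rightarrow> bool" where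
  "local_data x0 e Ob \<longleftrightarrow> 0 < e \<and> e < 1 \<and> open Ob \<and> x0 \<in> Ob"

text \<open>The defining property of the constant \<open>\<gamma>\<^sub>1(L)\<close>, the numbers \<open>a\<close>, \<open>b\<close> and the adapted norm
  being part of the data that come with \<open>L\<close>.\<close>

definition straightening_constant ::
    "('a::banach \<Rightarrow>\<^sub>L 'a) \<Rightarrow> real \<Rightarrow> real \<Rightarrow> ('a \<Rightarrow> real) \<Rightarrow> real \<Rightarrow> bool" where
  "straightening_constant L a b nrm g1 \<longleftrightarrow>
     0 < g1 \<and>
     (\<forall>R N g. continuous_on UNIV R \<and> weakly_hyperbolic_with R 0 L N a b nrm g \<and> g < g1 \<longrightarrow>
       (\<exists>Ob Vu Vs h N1 g' e Ob'.
          open Ob \<and> 0 \<in> Ob \<and>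
          openin (top_of_set (space_u L)) Vu \<and> 0 \<in> Vu \<and>
          openin (top_of_set (space_s L)) Vs \<and> 0 \<in> Vs \<and>
          bi_lipschitz UNIV UNIV h \<and> h 0 = 0 \<and>
          weakly_hyperbolic_with (inv h \<circ> R \<circ> h) 0 L N1 a b nrm g' \<and>
          local_data 0 e Ob' \<and>
          local_unstable (inv h \<circ> R \<circ> h) 0 e Ob' \<inter> Ob = Vu \<and>
          local_stable (inv h \<circ> R \<circ> h) 0 e Ob' \<inter> Ob = Vs \<and>
          (\<forall>x\<in>Vs. proj_u L (N1 x) = 0) \<and> (\<forall>x\<in>Vu. proj_s L (N1 x) = 0)))"

definition LL_hyperbolic_with :: "('a::banach \<Rightarrow> 'a) \<Rightarrow> 'a \<Rightarrow> ('a \<Rightarrow>\<^sub>L 'a) \<Rightarrow> bool" where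
  "LL_hyperbolic_with T x0 L \<longleftrightarrow>
     (\<exists>N a b nrm g g1. weakly_hyperbolic_with T x0 L N a b nrm g \<and>
        straightening_constant L a b nrm g1 \<and> g < g1)"

definition LL_hyperbolic :: "('a::banach \<Rightarrow> 'a) \<Rightarrow> 'a \<Rightarrow> bool" where
  "LL_hyperbolic T x0 \<longleftrightarrow> (\<exists>L. LL_hyperbolic_with T x0 L)"

text \<open>Below \<open>h\<close> is the parameter of the family, \<open>x h\<close> the equilibrium of \<open>T h\<close>, and the local manifolds of \<open>T h\<close> are those
  determined by the rate \<open>e h\<close> and the neighbourhood \<open>Ob h\<close>. The splitting
  is the one of the single operator \<open>L\<close>, which belongs to the parameter \<open>0\<close>.\<close>

definition stable_family_continuous ::
    "('a::banach \<Rightarrow>\<^sub>L 'a) \<Rightarrow> (real \<Rightarrow> 'a \<Rightarrow> 'a) \<Rightarrow> (real \<Rightarrow> 'a) \<Rightarrow> (real \<Rightarrow> real) \<Rightarrow> (real \<Rightarrow> 'a set)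
       \<Rightarrow> bool" where
  "stable_family_continuous L T x e Ob \<longleftrightarrow>
     (\<exists>Vs s. openin (top_of_set (space_s L)) Vs \<and> 0 \<in> Vs \<and>
        (\<exists>h0. 0 < h0 \<and> h0 \<le> 1 \<and>
          (\<forall>h\<in>{0..h0}. s h ` Vs \<subseteq> space_u L \<and> (\<exists>C. C-lipschitz_on Vs (s h)) \<and>
             local_stable (T h) (x h) (e h) (Ob h) = (\<lambda>m. x h + s h m + m) ` Vs)) \<and>
        ((\<lambda>h. lip_norm_on Vs (\<lambda>m. s h m - s 0 m)) \<longlongrightarrow> 0) (at_right 0))"

definition unstable_family_continuous ::
    "nat \<Rightarrow> ('a::banach \<Rightarrow>\<^sub>L 'a) \<Rightarrow> (real \<Rightarrow> 'a \<Rightarrow> 'a) \<Rightarrow> (real \<Rightarrow> 'a) \<Rightarrow> (real \<Rightarrow> real)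
       \<Rightarrow> (real \<Rightarrow> 'a set) \<Rightarrow> bool" where
  "unstable_family_continuous n L T x e Ob \<longleftrightarrow>
     (\<exists>Vu s. openin (top_of_set (space_u L)) Vu \<and> 0 \<in> Vu \<and>
        (\<exists>h0. 0 < h0 \<and> h0 \<le> 1 \<and>
          (\<forall>h\<in>{0..h0}. s h ` Vu \<subseteq> space_s L \<and> (\<exists>C. C-lipschitz_on Vu (s h)) \<and>
             local_unstable (T h) (x h) (e h) (Ob h) = (\<lambda>k. x h + k + s h k) ` Vu)) \<and>
        ((\<lambda>h. lip_norm_on Vu (\<lambda>k. s h k - s 0 k)) \<longlongrightarrow> 0) (at_right 0) \<and>
        ((\<lambda>h. lip_norm_on Vu
            (\<lambda>k. (T h ^^ n) (x h + k + s h k) - (T 0 ^^ n) (x 0 + k + s 0 k))) \<longlongrightarrow> 0)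
          (at_right 0))"

end

theory Submission
  imports Defs
begin

text \<open>In coordinates centred at its equilibrium, every map of the family has the form
  \<open>z \<mapsto> L z + N\<^sub>h z\<close> near \<open>0\<close>, where the hyperbolic operator \<open>L\<close> is the one that belongs to the parameter
  \<open>0\<close> and \<open>N\<^sub>h\<close> has a small Lipschitz constant \<open>g\<close> on a ball that does not depend on \<open>h\<close>.

  The stable manifold collects the forward orbits that stay in a small ball, the unstable one the
  backward orbits that do so. On the component that \<open>L\<close> expands, the equation
  \<open>z' = L z + N z\<close> is solved for \<open>z\<close> by means of \<open>L\<^sup>-\<^sup>1\<close>; on the contracted component it is read as it
  stands. Both kinds of orbits then solve the same problem for sequences: one component is given at
  time \<open>0\<close>, and every term is a contraction, with constant \<open>\<kappa> = max (b + g) ((1 + g) / a) < 1\<close>, of itself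
  and its neighbours. This Lyapunov-Perron problem has exactly one solution in the ball, which depends on the
  prescribed component with Lipschitz constant \<open>1\<close> and decays like \<open>\<kappa> ^ n\<close>. Its free component at
  time \<open>0\<close> is the function whose graph is the manifold, so that the local manifolds in a ball of
  the adapted norm are exactly graphs over balls of the same radius
  (\<open>local_stable_graph\<close>, \<open>local_unstable_graph\<close>).

  The dependence on \<open>h\<close> is compared along orbits. If \<open>z, z'\<close> are the solutions for the parameter \<open>h\<close>
  and \<open>w, w'\<close> those for the parameter \<open>0\<close>, with the same prescribed components \<open>\<xi>, \<xi>'\<close>, then \<open>z - w\<close> is
  small because \<open>N\<^sub>h - N\<^sub>0\<close> is, and the double difference \<open>e = (z - z') - (w - w')\<close> satisfies
  inequalities of the same kind, with zero data and a small multiple of \<open>norm (\<xi> - \<xi>')\<close> as error. This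
  rests on the estimate
  \<open>norm (N\<^sub>h p - N\<^sub>h p' - (N\<^sub>0 q - N\<^sub>0 q')) \<le> g * norm (p - p' - (q - q')) + \<epsilon> * norm (p - p')\<close>
  for \<open>p\<close> near \<open>q\<close> and \<open>p'\<close> near \<open>q'\<close>. It is the central notion of the proof (\<open>regular_family\<close>) and
  holds because \<open>T\<^sub>h - T\<^sub>0\<close> tends to \<open>0\<close> in the Lipschitz norm and the derivative of \<open>T\<^sub>0\<close> is uniformly
  continuous (\<open>regular_shifted_family\<close>). The first term on the right is absorbed by \<open>\<kappa> < 1\<close>, the second
  one is the error, and convergence of the graphs in the Lipschitz norm follows (\<open>orbit_family\<close>).

  The same estimate shows that composition with \<open>T\<^sub>h\<close> preserves convergence in the Lipschitz norm
  (\<open>lip_tendsto_compose\<close>). The radius of the ball is chosen in dependence on \<open>n\<close>, so small that the first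
  \<open>n\<close> iterates of the unstable manifold remain where the estimate is available.\<close>

section \<open>Equivalent norms\<close>

locale adapted_norm =
  fixes nrm :: "'a::banach \<Rightarrow> real"
  assumes equiv: "equivalent_norm nrm"
begin

lemma triangle: "nrm (x + y) \<le> nrm x + nrm y"
  and scale: "nrm (c *\<^sub>R x) = \<bar>c\<bar> * nrm x"
  using equiv unfolding equivalent_norm_def by auto

lemma comparison:
  "\<exists>c C. 0 < c \<and> 0 < C \<and> (\<forall>x. c * norm x \<le> nrm x) \<and> (\<forall>x. nrm x \<le> C * norm x)"
proof -
  obtain c C where c: "c > 0" "\<And>x. c * norm x \<le> nrm x \<and> nrm x \<le> C * norm x"
    using equiv unfolding equivalent_norm_def by auto
  have "nrm x \<le> max C 1 * norm x" for x
    using c(2)[of x] mult_right_mono[of C "max C 1" "norm x"] by simp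
  with c show ?thesis by (intro exI[of _ c] exI[of _ "max C 1"]) auto
qed

lemma nrm_zero [simp]: "nrm 0 = 0"
  using scale[of 0 0] by simp

lemma nrm_minus [simp]: "nrm (- x) = nrm x"
  using scale[of "-1" x] by simp

lemma nrm_nonneg [simp]: "0 \<le> nrm x"
  using triangle[of x "-x"] by simp

lemma nrm_eq_0 [simp]: "nrm x = 0 \<longleftrightarrow> x = 0"
proof
  assume "nrm x = 0"
  obtain c C where "0 < c" "\<And>x. c * norm x \<le> nrm x" using comparison by blast
  with \<open>nrm x = 0\<close> have "c * norm x \<le> 0" by metis
  with \<open>0 < c\<close> show "x = 0" by (simp add: mult_le_0_iff)
qed simp

lemma nrm_commute: "nrm (x - y) = nrm (y - x)"
  using nrm_minus[of "x - y"] by simp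

lemma triangle_diff: "nrm (x - y) \<le> nrm x + nrm y"
  using triangle[of x "-y"] by simp

lemma tendsto_iff_nrm: "(X \<longlongrightarrow> l) F \<longleftrightarrow> ((\<lambda>k. nrm (X k - l)) \<longlongrightarrow> 0) F"
proof -
  obtain c C where c: "0 < c" "0 < C" "\<And>x. c * norm x \<le> nrm x" "\<And>x. nrm x \<le> C * norm x"
    using comparison by blast
  show ?thesis
  proof
    assume "(X \<longlongrightarrow> l) F"
    then have "((\<lambda>k. C * norm (X k - l)) \<longlongrightarrow> 0) F"
      by (auto intro!: tendsto_mult_right_zero simp: tendsto_norm_zero_iff LIM_zero_iff)
    then show "((\<lambda>k. nrm (X k - l)) \<longlongrightarrow> 0) F"
      by (rule tendsto_0_le[where K = 1]) (use c in auto)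
  next
    assume *: "((\<lambda>k. nrm (X k - l)) \<longlongrightarrow> 0) F"
    have "((\<lambda>k. X k - l) \<longlongrightarrow> 0) F"
      by (rule tendsto_0_le[OF *, where K = "1 / c"]) (use c in \<open>auto simp: field_simps\<close>)
    then show "(X \<longlongrightarrow> l) F" by (simp add: LIM_zero_iff)
  qed
qed

lemma continuous_nrm: "continuous_on UNIV nrm"
proof -
  have "\<bar>nrm x - nrm y\<bar> \<le> nrm (x - y)" for x y
    using triangle[of "x - y" y] triangle[of "y - x" x] by (simp add: nrm_commute)
  then have "((\<lambda>y. nrm y - nrm x) \<longlongrightarrow> 0) (at x)" for x
    using tendsto_ident_at[of x UNIV]
    unfolding tendsto_iff_nrm[of "\<lambda>y. y" x] by (rule_tac tendsto_0_le[where K = 1]) auto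
  then show ?thesis by (simp add: continuous_on_def LIM_zero_iff)
qed

lemma open_nrm_ball: "open {y. nrm (y - x) < r}"
proof -
  have "open (nrm -` {..<r})"
    by (rule open_vimage[OF _ continuous_nrm]) simp
  then have "open ((\<lambda>y. - x + y) -` (nrm -` {..<r}))"
    by (rule open_vimage) (intro continuous_intros)
  then show ?thesis by (simp add: vimage_def)
qed

lemma nrm_ball_in_open:
  assumes "open S" "x \<in> S"
  obtains r where "0 < r" "\<And>y. nrm (y - x) < r \<Longrightarrow> y \<in> S"
proof -
  obtain e where e: "e > 0" "ball x e \<subseteq> S" using assms open_contains_ball by blast
  obtain c C where c: "0 < c" "\<And>x. c * norm x \<le> nrm x" using comparison by blast
  show ?thesis
  proof (rule that[of "c * e"])
    fix y assume "nrm (y - x) < c * e"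
    with c(2)[of "y - x"] have "c * norm (y - x) < c * e" by simp
    with c(1) have "norm (y - x) < e" by simp
    with e(2) show "y \<in> S" by (auto simp: dist_norm norm_minus_commute)
  qed (use e c in auto)
qed

lemma convergent_geometric:
  assumes "\<And>k. nrm (X (Suc k) - X k) \<le> q ^ k * C" "0 \<le> q" "q < 1"
  shows "convergent X"
proof -
  obtain c C' where c: "0 < c" "\<And>x. c * norm x \<le> nrm x" using comparison by blast
  have le: "norm (X (Suc k) - X k) \<le> q ^ k * (C / c)" for k
    using c(1) order_trans[OF c(2) assms(1)[of k]] by (simp add: field_simps)
  have "summable (\<lambda>k. q ^ k * (C / c))"
    using assms by (intro summable_mult2 summable_geometric) auto
  then have "summable (\<lambda>k. X (Suc k) - X k)"
    by (rule summable_comparison_test'[where N = 0]) (use le in auto)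
  then have "convergent (\<lambda>n. \<Sum>k<n. X (Suc k) - X k)"
    by (simp add: summable_iff_convergent)
  then have "convergent (\<lambda>n. (X n - X 0) + X 0)"
    by (intro convergent_add convergent_const) (simp add: sum_lessThan_telescope)
  then show ?thesis by simp
qed

text \<open>Convergence in the extended-valued Lipschitz norm, in terms of \<open>nrm\<close>: equivalent norms change \<open>\<epsilon>\<close>
  only by a constant factor. All later estimates use the right-hand side.\<close>

lemma lip_norm_tendsto_0_iff:
  "((\<lambda>h. lip_norm_on V (f h)) \<longlongrightarrow> 0) F \<longleftrightarrow>
     (\<forall>\<epsilon>>0. \<forall>\<^sub>F h in F. (\<forall>x\<in>V. nrm (f h x) \<le> \<epsilon>) \<and>
                         (\<forall>x\<in>V. \<forall>y\<in>V. nrm (f h x - f h y) \<le> \<epsilon> * nrm (x - y)))"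
proof -
  have le: "lip_norm_on V u \<le> ennreal \<epsilon> \<longleftrightarrow> (\<forall>x\<in>V. norm (u x) \<le> \<epsilon>) \<and>
      (\<forall>x\<in>V. \<forall>y\<in>V. norm (u x - u y) \<le> \<epsilon> * norm (x - y))" if "\<epsilon> > 0" 
    for u :: "'a \<Rightarrow> 'a" and \<epsilon>
  proof -
    have "sup_norm_on V u \<le> ennreal \<epsilon> \<longleftrightarrow> (\<forall>x\<in>V. norm (u x) \<le> \<epsilon>)"
      using that by (auto simp: sup_norm_on_def SUP_le_iff ennreal_le_iff)
    moreover have "norm (u x - u y) / norm (x - y) \<le> \<epsilon> \<longleftrightarrow> norm (u x - u y) \<le> \<epsilon> * norm (x - y)"
      if "x \<noteq> y" for x y
      using that by (simp add: field_simps)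
    then have "lip_seminorm_on V u \<le> ennreal \<epsilon> \<longleftrightarrow> 
      (\<forall>x\<in>V. \<forall>y\<in>V. x \<noteq> y \<longrightarrow> norm (u x - u y) \<le> \<epsilon> * norm (x - y))"
      using that by (auto simp: lip_seminorm_on_def SUP_le_iff ennreal_le_iff)
    moreover have "(\<forall>x\<in>V. \<forall>y\<in>V. x \<noteq> y \<longrightarrow> norm (u x - u y) \<le> \<epsilon> * norm (x - y)) \<longleftrightarrow>
        (\<forall>x\<in>V. \<forall>y\<in>V. norm (u x - u y) \<le> \<epsilon> * norm (x - y))"
      by (rule iffI; intro ballI impI; rename_tac x y; case_tac "x = y"; simp)
    ultimately show ?thesis by (simp add: lip_norm_on_def)
  qed
  obtain c C where c: "0 < c" "0 < C" "\<And>x. c * norm x \<le> nrm x" "\<And>x. nrm x \<le> C * norm x"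
    using comparison by blast
  show ?thesis (is "?L \<longleftrightarrow> ?R")
  proof
    assume L: ?L
    show ?R
    proof (intro allI impI)
      fix \<epsilon> :: real assume \<epsilon>: "\<epsilon> > 0"
      define d where "d = \<epsilon> * min c 1 / C"
      have d: "d > 0" using c \<epsilon> by (simp add: d_def)
      have d1: "C * d \<le> \<epsilon>" "C * d \<le> \<epsilon> * c"
        using c \<epsilon> by (simp_all add: d_def)
      have "\<forall>\<^sub>F h in F. lip_norm_on V (f h) < ennreal d"
        by (rule order_tendstoD(2)[OF L]) (simp add: d)
      then show "\<forall>\<^sub>F h in F. (\<forall>x\<in>V. nrm (f h x) \<le> \<epsilon>) \<and>
            (\<forall>x\<in>V. \<forall>y\<in>V. nrm (f h x - f h y) \<le> \<epsilon> * nrm (x - y))"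
      proof eventually_elim
        case (elim h)
        then have *: "\<And>x. x\<in>V \<Longrightarrow> norm (f h x) \<le> d"
            "\<And>x y. x\<in>V \<Longrightarrow> y\<in>V \<Longrightarrow> norm (f h x - f h y) \<le> d * norm (x - y)"
          using le[OF d, of "f h"] by auto
        have "nrm (f h x) \<le> \<epsilon>" if "x \<in> V" for x
          using c(4)[of "f h x"] mult_left_mono[OF *(1)[OF that], of C] c(2) d1 by linarith
        moreover have "nrm (f h x - f h y) \<le> \<epsilon> * nrm (x - y)" if "x \<in> V" "y \<in> V" for x y
        proof -
          have "nrm (f h x - f h y) \<le> C * (d * norm (x - y))"
            using c(4)[of "f h x - f h y"] mult_left_mono[OF *(2)[OF that], of C] c(2) by linarith
          also have "\<dots> \<le> (\<epsilon> * c) * norm (x - y)"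
            using mult_right_mono[OF d1(2), of "norm (x - y)"] by (simp add: mult.assoc)
          also have "\<dots> \<le> \<epsilon> * nrm (x - y)"
            using mult_left_mono[OF c(3), of \<epsilon>] \<epsilon> by (simp add: mult.assoc)
          finally show ?thesis .
        qed
        ultimately show ?case by blast
      qed
    qed
  next
    assume R: ?R
    show ?L
    proof (rule order_tendstoI)
      fix l :: ennreal assume "l > 0"
      obtain q where q: "q > 0" "ennreal q < l"
      proof -
        obtain s where "0 < s" "s < l" using dense[OF \<open>l > 0\<close>] by blast
        moreover then obtain q where "s = ennreal q" "q \<ge> 0"
          by (cases s) auto
        ultimately show ?thesis using that[of q] by (auto simp: ennreal_less_zero_iff)
      qed
      define d where "d = q * min c 1 / max C 1"
      have d: "d > 0" using c q by (simp add: d_def)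
      have d1: "d / c \<le> q" "C * d \<le> q * c" 
      proof -
        have "d * max C 1 = q * min c 1" using c by (simp add: d_def)
        moreover have "d * C \<le> d * max C 1" "d * 1 \<le> d * max C 1"
          using d by (intro mult_left_mono; simp)+
        moreover have "q * min c 1 \<le> q * c" using q by simp
        ultimately have "d \<le> q * c" "C * d \<le> q * c" by (auto simp: mult.commute)
        then show "d / c \<le> q" "C * d \<le> q * c" using c by (auto simp: field_simps)
      qed
      have "\<forall>\<^sub>F h in F. (\<forall>x\<in>V. nrm (f h x) \<le> d) \<and>
            (\<forall>x\<in>V. \<forall>y\<in>V. nrm (f h x - f h y) \<le> d * nrm (x - y))"
        using R d by blast
      then show "\<forall>\<^sub>F h in F. lip_norm_on V (f h) < l"
      proof eventually_elim
        case (elim h)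
        have "norm (f h x) \<le> q" if "x \<in> V" for x
        proof -
          have "c * norm (f h x) \<le> d" using elim that c(3)[of "f h x"] by fastforce
          then have "norm (f h x) \<le> d / c" using c by (simp add: field_simps)
          with d1 show ?thesis by linarith
        qed
        moreover have "norm (f h x - f h y) \<le> q * norm (x - y)" if "x \<in> V" "y \<in> V" for x y
        proof -
          have "c * norm (f h x - f h y) \<le> d * nrm (x - y)" 
            using elim that c(3)[of "f h x - f h y"] by fastforce
          also have "\<dots> \<le> d * (C * norm (x - y))" using d c by (intro mult_left_mono) auto
          also have "\<dots> \<le> (q * c) * norm (x - y)"
            using mult_right_mono[OF d1(2), of "norm (x - y)"] by (simp add: mult_ac)
          finally have "c * norm (f h x - f h y) \<le> c * (q * norm (x - y))" by (simp add: mult_ac)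
          then show ?thesis using c by simp
        qed
        ultimately have "lip_norm_on V (f h) \<le> ennreal q"
          using le[OF q(1), of "f h"] by auto
        with q show ?case by (rule_tac le_less_trans)
      qed
    qed simp
  qed
qed

lemma blinfun_nrm_bound: "\<exists>\<Lambda>\<ge>0. \<forall>x. nrm (blinfun_apply A x) \<le> \<Lambda> * nrm x"
proof -
  obtain c C where c: "0 < c" "0 < C" "\<And>x. c * norm x \<le> nrm x" "\<And>x. nrm x \<le> C * norm x"
    using comparison by blast
  have "nrm (blinfun_apply A x) \<le> C * norm A / c * nrm x" for x
  proof -
    have "nrm (blinfun_apply A x) \<le> C * (norm A * norm x)"
      using c(4)[of "blinfun_apply A x"] mult_left_mono[OF norm_blinfun[of A x], of C] c(2) by linarith
    moreover have "(C * norm A / c) * (c * norm x) \<le> (C * norm A / c) * nrm x"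
      using c by (intro mult_left_mono) auto
    ultimately show ?thesis using c(1) by simp
  qed
  moreover have "0 \<le> C * norm A / c" using c by simp
  ultimately show ?thesis by blast
qed

lemma lipschitz_on_of_nrm:
  assumes "\<And>x y. x \<in> V \<Longrightarrow> y \<in> V \<Longrightarrow> nrm (s x - s y) \<le> M * nrm (x - y)" "0 \<le> M"
  shows "\<exists>C. C-lipschitz_on V s"
proof -
  obtain c C where c: "0 < c" "0 < C" "\<And>x. c * norm x \<le> nrm x" "\<And>x. nrm x \<le> C * norm x"
    using comparison by blast
  have "(M * C / c)-lipschitz_on V s"
  proof (rule lipschitz_onI)
    fix x y assume xy: "x \<in> V" "y \<in> V"
    have "c * norm (s x - s y) \<le> M * (C * norm (x - y))"
      using c(3)[of "s x - s y"] assms(1)[OF xy] mult_left_mono[OF c(4)[of "x - y"] assms(2)] by linarith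
    then show "dist (s x) (s y) \<le> M * C / c * dist x y" using c(1) by (simp add: dist_norm field_simps)
  qed (use c assms in auto)
  then show ?thesis by blast
qed

lemma smallo_of_decay:
  assumes "\<And>n. nrm (z n) \<le> k ^ n * c" "0 \<le> k" "k < q"
  shows "(\<lambda>n. norm (z n)) \<in> o(\<lambda>n. q ^ n)"
proof -
  obtain c1 where c1: "0 < c1" "\<And>x. c1 * norm x \<le> nrm x" using comparison by blast
  have "(\<lambda>n. (c / c1) * (k / q) ^ n) \<longlonglongrightarrow> 0"
    using assms(2,3) by (intro tendsto_mult_right_zero LIMSEQ_power_zero) auto
  then have "(\<lambda>n. norm (z n) / q ^ n) \<longlonglongrightarrow> 0"
  proof (rule tendsto_0_le[where K = 1], intro always_eventually allI)
    fix n
    have q: "0 < q ^ n" using assms(2,3) by simp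
    have "c1 * norm (z n) \<le> k ^ n * c" using c1(2)[of "z n"] assms(1)[of n] by linarith
    then have "norm (z n) \<le> k ^ n * (c / c1)" using c1(1) by (simp add: field_simps)
    then have "norm (z n) / q ^ n \<le> k ^ n * (c / c1) / q ^ n" 
      by (rule divide_right_mono) (use q in simp)
    also have "\<dots> = (c / c1) * (k / q) ^ n" by (simp add: power_divide)
    also have "\<dots> \<le> \<bar>(c / c1) * (k / q) ^ n\<bar>" by (rule abs_ge_self)
    finally show "norm (norm (z n) / q ^ n) \<le> norm (c / c1 * (k / q) ^ n) * 1"
      using q by simp
  qed
  then show ?thesis using assms(2,3) by (intro smalloI_tendsto) auto
qed

end

section \<open>Families of maps near the parameter zero\<close>

lemma eventually_at_right_0_Icc:
  fixes h0 :: real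
  assumes "0 < h0"
  shows "\<forall>\<^sub>F h in at_right 0. h \<in> {0..h0}"
  using eventually_at_right_real[OF assms] by eventually_elim auto

context adapted_norm
begin

text \<open>The second condition combines three facts: \<open>f h\<close> tends to \<open>f 0\<close> in the Lipschitz seminorm, \<open>k\<close> bounds
  the effect of a change of the increment, and increments of \<open>f 0\<close> depend uniformly continuously on the
  base point, as they do when the derivative of \<open>f 0\<close> is uniformly continuous. Stated for four points, it applies directly to double differences of
  orbits, and it passes to expressions built linearly from \<open>f\<close>. The norm \<open>nb\<close> of the domain is a
  parameter because the maps of pairs below are measured in a maximum norm.\<close>

definition regular_family ::
    "('b::ab_group_add \<Rightarrow> real) \<Rightarrow> 'b set \<Rightarrow> real \<Rightarrow> (real \<Rightarrow> 'b \<Rightarrow> 'a) \<Rightarrow> bool" where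
  "regular_family nb S k f \<longleftrightarrow>
     (\<forall>\<epsilon>>0. \<forall>\<^sub>F h in at_right 0. \<forall>p\<in>S. nrm (f h p - f 0 p) \<le> \<epsilon>) \<and>
     (\<forall>\<epsilon>>0. \<exists>\<delta>>0. \<forall>\<^sub>F h in at_right 0. \<forall>p\<in>S. \<forall>p'\<in>S. \<forall>q\<in>S. \<forall>q'\<in>S.
        nb (p - q) \<le> \<delta> \<longrightarrow> nb (p' - q') \<le> \<delta> \<longrightarrow>
        nrm (f h p - f h p' - (f 0 q - f 0 q')) \<le> k * nb (p - p' - (q - q')) + \<epsilon> * nb (p - p'))"

lemma regular_family_tendsto:
  "regular_family nb S k f \<Longrightarrow> 0 < \<epsilon> \<Longrightarrow> \<forall>\<^sub>F h in at_right 0. \<forall>p\<in>S. nrm (f h p - f 0 p) \<le> \<epsilon>"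
  by (simp add: regular_family_def)

lemma regular_family_double_difference:
  "regular_family nb S k f \<Longrightarrow> 0 < \<epsilon> \<Longrightarrow>
     \<exists>\<delta>>0. \<forall>\<^sub>F h in at_right 0. \<forall>p\<in>S. \<forall>p'\<in>S. \<forall>q\<in>S. \<forall>q'\<in>S.
        nb (p - q) \<le> \<delta> \<longrightarrow> nb (p' - q') \<le> \<delta> \<longrightarrow>
        nrm (f h p - f h p' - (f 0 q - f 0 q')) \<le> k * nb (p - p' - (q - q')) + \<epsilon> * nb (p - p')"
  by (simp add: regular_family_def)

lemma regular_family_mono:
  assumes "regular_family nrm S k f" "k \<le> k'"
  shows "regular_family nrm S k' f"
  unfolding regular_family_def
proof (intro conjI allI impI)
  fix \<epsilon> :: real assume \<epsilon>: "0 < \<epsilon>"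
  show "\<forall>\<^sub>F h in at_right 0. \<forall>p\<in>S. nrm (f h p - f 0 p) \<le> \<epsilon>"
    by (rule regular_family_tendsto[OF assms(1) \<epsilon>])
  obtain \<delta> where \<delta>: "\<delta> > 0" "\<forall>\<^sub>F h in at_right 0. \<forall>p\<in>S. \<forall>p'\<in>S. \<forall>q\<in>S. \<forall>q'\<in>S.
        nrm (p - q) \<le> \<delta> \<longrightarrow> nrm (p' - q') \<le> \<delta> \<longrightarrow>
        nrm (f h p - f h p' - (f 0 q - f 0 q')) \<le> k * nrm (p - p' - (q - q')) + \<epsilon> * nrm (p - p')"
    using regular_family_double_difference[OF assms(1) \<epsilon>] by blast
  from \<delta>(2) have "\<forall>\<^sub>F h in at_right 0. \<forall>p\<in>S. \<forall>p'\<in>S. \<forall>q\<in>S. \<forall>q'\<in>S.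
        nrm (p - q) \<le> \<delta> \<longrightarrow> nrm (p' - q') \<le> \<delta> \<longrightarrow>
        nrm (f h p - f h p' - (f 0 q - f 0 q')) \<le> k' * nrm (p - p' - (q - q')) + \<epsilon> * nrm (p - p')"
  proof eventually_elim
    case (elim h)
    have "k * nrm v \<le> k' * nrm v" for v using assms(2) by (simp add: mult_right_mono)
    with elim show ?case by (meson add_right_mono order_trans)
  qed
  with \<delta>(1) show "\<exists>\<delta>>0. \<forall>\<^sub>F h in at_right 0. \<forall>p\<in>S. \<forall>p'\<in>S. \<forall>q\<in>S. \<forall>q'\<in>S.
        nrm (p - q) \<le> \<delta> \<longrightarrow> nrm (p' - q') \<le> \<delta> \<longrightarrow>
        nrm (f h p - f h p' - (f 0 q - f 0 q')) \<le> k' * nrm (p - p' - (q - q')) + \<epsilon> * nrm (p - p')"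
    by blast
qed

text \<open>The four-point estimate with \<open>q = p\<close> and \<open>q' = p'\<close> compares increments of \<open>f h\<close> and of \<open>f 0\<close>.\<close>

lemma regular_family_lipschitz:
  assumes "regular_family nrm S k f" "k < k'" "0 \<le> k"
    and "\<And>p q. p \<in> S \<Longrightarrow> q \<in> S \<Longrightarrow> nrm (f 0 p - f 0 q) \<le> k * nrm (p - q)"
  shows "\<forall>\<^sub>F h in at_right 0. \<forall>p\<in>S. \<forall>q\<in>S. nrm (f h p - f h q) \<le> k' * nrm (p - q)"
proof -
  obtain \<delta> where \<delta>: "\<delta> > 0" "\<forall>\<^sub>F h in at_right 0. \<forall>p\<in>S. \<forall>p'\<in>S. \<forall>q\<in>S. \<forall>q'\<in>S.
        nrm (p - q) \<le> \<delta> \<longrightarrow> nrm (p' - q') \<le> \<delta> \<longrightarrow>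
        nrm (f h p - f h p' - (f 0 q - f 0 q')) \<le> k * nrm (p - p' - (q - q')) + (k' - k) * nrm (p - p')"
    using regular_family_double_difference[OF assms(1), of "k' - k"] assms(2) by auto
  from \<delta>(2) show ?thesis
  proof eventually_elim
    case (elim h)
    show ?case
    proof (intro ballI)
      fix p q assume pq: "p \<in> S" "q \<in> S"
      have "nrm (p - p) \<le> \<delta>" "nrm (q - q) \<le> \<delta>" using \<delta>(1) by simp_all
      then have "nrm (f h p - f h q - (f 0 p - f 0 q)) \<le> k * nrm (p - q - (p - q)) + (k' - k) * nrm (p - q)"
        using elim pq by blast
      then show "nrm (f h p - f h q) \<le> k' * nrm (p - q)"
        using triangle[of "f h p - f h q - (f 0 p - f 0 q)" "f 0 p - f 0 q"] assms(4)[OF pq]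
        by (simp add: left_diff_distrib)
    qed
  qed
qed

definition lip_tendsto :: "'a set \<Rightarrow> (real \<Rightarrow> 'a \<Rightarrow> 'a) \<Rightarrow> bool" where
  "lip_tendsto V u \<longleftrightarrow> (\<forall>\<epsilon>>0. \<forall>\<^sub>F h in at_right 0. (\<forall>x\<in>V. nrm (u h x - u 0 x) \<le> \<epsilon>) \<and>
     (\<forall>x\<in>V. \<forall>y\<in>V. nrm (u h x - u 0 x - (u h y - u 0 y)) \<le> \<epsilon> * nrm (x - y)))"

lemma lip_tendstoD:
  assumes "lip_tendsto V u" "0 < \<epsilon>"
  shows "\<forall>\<^sub>F h in at_right 0. (\<forall>x\<in>V. nrm (u h x - u 0 x) \<le> \<epsilon>) \<and>
     (\<forall>x\<in>V. \<forall>y\<in>V. nrm (u h x - u 0 x - (u h y - u 0 y)) \<le> \<epsilon> * nrm (x - y))"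
  using assms by (simp add: lip_tendsto_def)

lemma lip_tendsto_iff_lip_norm:
  "lip_tendsto V u \<longleftrightarrow> ((\<lambda>h. lip_norm_on V (\<lambda>x. u h x - u 0 x)) \<longlongrightarrow> 0) (at_right 0)"
  by (simp add: lip_tendsto_def lip_norm_tendsto_0_iff)

text \<open>The outer maps depend on the parameter and the inner ones move, so neither the triangle inequality
  for \<open>f h - f 0\<close> nor a Lipschitz bound of \<open>f 0\<close> alone controls the Lipschitz seminorm; the four-point
  estimate for the values of \<open>u h\<close> and \<open>u 0\<close> does both at once.\<close>

lemma lip_tendsto_compose:
  assumes f: "regular_family nrm S K f" and u: "lip_tendsto V u"
    and uS: "\<forall>\<^sub>F h in at_right 0. \<forall>x\<in>V. u h x \<in> S" "\<And>x. x \<in> V \<Longrightarrow> u 0 x \<in> S"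
    and f0: "\<And>p q. p \<in> S \<Longrightarrow> q \<in> S \<Longrightarrow> nrm (f 0 p - f 0 q) \<le> K * nrm (p - q)"
    and u0: "\<And>x y. x \<in> V \<Longrightarrow> y \<in> V \<Longrightarrow> nrm (u 0 x - u 0 y) \<le> M * nrm (x - y)"
    and K: "0 \<le> K" and M: "0 \<le> M"
  shows "lip_tendsto V (\<lambda>h x. f h (u h x))"
  unfolding lip_tendsto_def
proof (intro allI impI)
  fix \<epsilon> :: real assume \<epsilon>: "0 < \<epsilon>"
  define \<epsilon>1 where "\<epsilon>1 = \<epsilon> / 2 / (M + 1)"
  have \<epsilon>1: "0 < \<epsilon>1" "\<epsilon>1 * (M + 1) = \<epsilon> / 2" using \<epsilon> M
    by (simp add: \<epsilon>1_def, intro nonzero_eq_divide_eq[THEN iffD1, OF _ \<epsilon>1_def]) simp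
  obtain \<delta> where \<delta>: "\<delta> > 0" "\<forall>\<^sub>F h in at_right 0. \<forall>p\<in>S. \<forall>p'\<in>S. \<forall>q\<in>S. \<forall>q'\<in>S.
        nrm (p - q) \<le> \<delta> \<longrightarrow> nrm (p' - q') \<le> \<delta> \<longrightarrow>
        nrm (f h p - f h p' - (f 0 q - f 0 q')) \<le> K * nrm (p - p' - (q - q')) + \<epsilon>1 * nrm (p - p')"
    using regular_family_double_difference[OF f \<epsilon>1(1)] by blast
  define \<epsilon>2 where "\<epsilon>2 = min (min 1 \<delta>) (\<epsilon> / 2 / (K + 1))"
  have \<epsilon>2: "0 < \<epsilon>2" "\<epsilon>2 \<le> 1" "\<epsilon>2 \<le> \<delta>" using \<delta> \<epsilon> K by (simp_all add: \<epsilon>2_def)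
  have "\<epsilon>2 \<le> \<epsilon> / 2 / (K + 1)" by (simp add: \<epsilon>2_def)
  then have "\<epsilon>2 * (K + 1) \<le> \<epsilon> / 2" using K by (subst (asm) pos_le_divide_eq) simp_all
  then have K\<epsilon>2: "K * \<epsilon>2 \<le> \<epsilon> / 2" using \<epsilon>2 by (simp add: distrib_left mult.commute)
  have "\<forall>\<^sub>F h in at_right 0. \<forall>p\<in>S. nrm (f h p - f 0 p) \<le> \<epsilon> / 2"
    using \<epsilon> by (intro regular_family_tendsto[OF f]) simp
  with \<delta>(2) uS(1) lip_tendstoD[OF u \<epsilon>2(1)]
  show "\<forall>\<^sub>F h in at_right 0. (\<forall>x\<in>V. nrm (f h (u h x) - f 0 (u 0 x)) \<le> \<epsilon>) \<and>
     (\<forall>x\<in>V. \<forall>y\<in>V. nrm (f h (u h x) - f 0 (u 0 x) - (f h (u h y) - f 0 (u 0 y))) \<le> \<epsilon> * nrm (x - y))"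
  proof eventually_elim
    case (elim h)
    have uh: "u h x \<in> S" if "x \<in> V" for x using elim(2) that by blast
    have close: "nrm (u h x - u 0 x) \<le> \<epsilon>2" if "x \<in> V" for x using elim(3) that by blast
    have lip: "nrm (u h x - u 0 x - (u h y - u 0 y)) \<le> \<epsilon>2 * nrm (x - y)" if "x \<in> V" "y \<in> V" for x y
      using elim(3) that by blast
    show ?case
    proof (intro conjI ballI)
      fix x assume x: "x \<in> V"
      have "nrm (f h (u h x) - f 0 (u 0 x)) \<le>
          nrm (f h (u h x) - f 0 (u h x)) + nrm (f 0 (u h x) - f 0 (u 0 x))"
        using triangle[of "f h (u h x) - f 0 (u h x)" "f 0 (u h x) - f 0 (u 0 x)"] by simp
      also have "nrm (f h (u h x) - f 0 (u h x)) \<le> \<epsilon> / 2" using elim(4) uh[OF x] by blast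
      also have "nrm (f 0 (u h x) - f 0 (u 0 x)) \<le> K * \<epsilon>2"
        using f0[OF uh[OF x] uS(2)[OF x]] mult_left_mono[OF close[OF x] K] by linarith
      finally show "nrm (f h (u h x) - f 0 (u 0 x)) \<le> \<epsilon>" using K\<epsilon>2 by linarith
      fix y assume y: "y \<in> V"
      have 1: "nrm (u h x - u h y - (u 0 x - u 0 y)) \<le> \<epsilon>2 * nrm (x - y)"
        using lip[OF x y] by (simp add: algebra_simps)
      have 2: "nrm (u h x - u h y) \<le> (M + 1) * nrm (x - y)"
        using triangle[of "u h x - u h y - (u 0 x - u 0 y)" "u 0 x - u 0 y"] 1 u0[OF x y] 
          mult_right_mono[OF \<epsilon>2(2), of "nrm (x - y)"] by (simp add: distrib_right)
      have "f h (u h x) - f 0 (u 0 x) - (f h (u h y) - f 0 (u 0 y)) =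
          f h (u h x) - f h (u h y) - (f 0 (u 0 x) - f 0 (u 0 y))" by simp
      also have "nrm \<dots> \<le> K * nrm (u h x - u h y - (u 0 x - u 0 y)) + \<epsilon>1 * nrm (u h x - u h y)"
      proof -
        have "nrm (u h x - u 0 x) \<le> \<delta>" "nrm (u h y - u 0 y) \<le> \<delta>"
          using close[OF x] close[OF y] \<epsilon>2(3) by linarith+
        then show ?thesis using elim(1) uh[OF x] uh[OF y] uS(2)[OF x] uS(2)[OF y] by blast
      qed
      also have "\<dots> \<le> K * (\<epsilon>2 * nrm (x - y)) + \<epsilon>1 * ((M + 1) * nrm (x - y))"
        using 1 2 K \<epsilon>1 by (intro add_mono mult_left_mono) auto
      also have "\<dots> = (K * \<epsilon>2 + \<epsilon>1 * (M + 1)) * nrm (x - y)" by (simp add: algebra_simps)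
      also have "\<dots> \<le> \<epsilon> * nrm (x - y)"
        using K\<epsilon>2 \<epsilon>1(2) by (intro mult_right_mono) auto
      finally show "nrm (f h (u h x) - f 0 (u 0 x) - (f h (u h y) - f 0 (u 0 y))) \<le> \<epsilon> * nrm (x - y)" .
    qed
  qed
qed

lemma lip_tendsto_add_const:
  assumes c: "((\<lambda>h. norm (c h - c 0)) \<longlongrightarrow> 0) (at_right 0)" and u: "lip_tendsto V u"
  shows "lip_tendsto V (\<lambda>h y. c h + u h y)"
  unfolding lip_tendsto_def
proof (intro allI impI)
  fix \<epsilon> :: real assume "0 < \<epsilon>"
  then have \<epsilon>: "0 < \<epsilon> / 2" by simp
  have "((\<lambda>h. nrm (c h - c 0)) \<longlongrightarrow> 0) (at_right 0)"
    using c by (simp flip: tendsto_iff_nrm add: tendsto_norm_zero_iff LIM_zero_iff)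
  then have "\<forall>\<^sub>F h in at_right 0. nrm (c h - c 0) < \<epsilon> / 2" using \<epsilon> by (rule order_tendstoD)
  with lip_tendstoD[OF u \<epsilon>]
  show "\<forall>\<^sub>F h in at_right 0. (\<forall>x\<in>V. nrm (c h + u h x - (c 0 + u 0 x)) \<le> \<epsilon>) \<and>
      (\<forall>x\<in>V. \<forall>y\<in>V. nrm (c h + u h x - (c 0 + u 0 x) - (c h + u h y - (c 0 + u 0 y))) \<le> \<epsilon> * nrm (x - y))"
  proof eventually_elim
    case (elim h)
    show ?case
    proof (intro conjI ballI)
      fix x assume x: "x \<in> V"
      have "nrm (c h + u h x - (c 0 + u 0 x)) \<le> nrm (c h - c 0) + nrm (u h x - u 0 x)"
        using triangle[of "c h - c 0" "u h x - u 0 x"] by (simp add: algebra_simps)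
      moreover have "nrm (u h x - u 0 x) \<le> \<epsilon> / 2" using elim(1) x by blast
      ultimately show "nrm (c h + u h x - (c 0 + u 0 x)) \<le> \<epsilon>"
        using elim(2) by linarith
      fix y assume y: "y \<in> V"
      have "nrm (u h x - u 0 x - (u h y - u 0 y)) \<le> \<epsilon> / 2 * nrm (x - y)" using elim(1) x y by blast
      also have "\<dots> \<le> \<epsilon> * nrm (x - y)" using \<epsilon> by (intro mult_right_mono) auto
      finally show "nrm (c h + u h x - (c 0 + u 0 x) - (c h + u h y - (c 0 + u 0 y))) \<le> \<epsilon> * nrm (x - y)"
        by (simp add: algebra_simps)
    qed
  qed
qed

end

section \<open>The family in coordinates centred at its equilibrium\<close>

context adapted_norm
begin

text \<open>Mean value inequality for \<open>y \<mapsto> f (x0 + (p + y)) - f (x0 + (q + y))\<close> on the segment from \<open>0\<close> to \<open>d\<close>: its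
  derivative is a difference of values of \<open>D\<close> at nearby points.\<close>

lemma derivative_double_difference:
  assumes D: "\<And>x. (f has_derivative blinfun_apply (D x)) (at x)"
    and uc: "uniformly_continuous_on W D" and W: "\<And>z. nrm z < \<rho> \<Longrightarrow> x0 + z \<in> W" and \<epsilon>: "0 < \<epsilon>"
  obtains \<delta> where "0 < \<delta>" "\<And>p q d. \<lbrakk>nrm p < \<rho>; nrm (p + d) < \<rho>; nrm q < \<rho>; nrm (q + d) < \<rho>; nrm (p - q) \<le> \<delta>\<rbrakk> \<Longrightarrow>
      nrm (f (x0 + (p + d)) - f (x0 + p) - (f (x0 + (q + d)) - f (x0 + q))) \<le> \<epsilon> * nrm d"
proof -
  obtain c C where c: "0 < c" "0 < C" "\<And>x. c * norm x \<le> nrm x" "\<And>x. nrm x \<le> C * norm x"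
    using comparison by blast
  define \<epsilon>' where "\<epsilon>' = \<epsilon> * c / C"
  have \<epsilon>': "0 < \<epsilon>'" using c \<epsilon> by (simp add: \<epsilon>'_def)
  obtain \<delta>' where \<delta>': "0 < \<delta>'" "\<And>x y. x \<in> W \<Longrightarrow> y \<in> W \<Longrightarrow> dist x y < \<delta>' \<Longrightarrow> dist (D x) (D y) < \<epsilon>'"
    using uc \<epsilon>' unfolding uniformly_continuous_on_def by metis
  show ?thesis
  proof (rule that[of "c * \<delta>' / 2"])
    show "0 < c * \<delta>' / 2" using c \<delta>' by simp
    fix p q d assume *: "nrm p < \<rho>" "nrm (p + d) < \<rho>" "nrm q < \<rho>" "nrm (q + d) < \<rho>" "nrm (p - q) \<le> c * \<delta>' / 2"
    have ball: "nrm (u + t *\<^sub>R d) < \<rho>" if "nrm u < \<rho>" "nrm (u + d) < \<rho>" "0 \<le> t" "t \<le> 1" for u t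
    proof -
      have "u + t *\<^sub>R d = (1 - t) *\<^sub>R u + t *\<^sub>R (u + d)" by (simp add: algebra_simps)
      then have "nrm (u + t *\<^sub>R d) \<le> (1 - t) * nrm u + t * nrm (u + d)"
        using triangle[of "(1 - t) *\<^sub>R u" "t *\<^sub>R (u + d)"] that by (simp add: scale)
      also have "\<dots> < \<rho>" using that by (intro convex_bound_lt) auto
      finally show ?thesis .
    qed
    define \<phi> where "\<phi> y = f (x0 + (p + y)) - f (x0 + (q + y))" for y
    have "norm (\<phi> d - \<phi> 0) \<le> \<epsilon>' * norm (d - 0)"
    proof (rule differentiable_bound[where S = "closed_segment 0 d" 
          and f' = "\<lambda>y. blinfun_apply (D (x0 + (p + y)) - D (x0 + (q + y)))"])
      fix y assume y: "y \<in> closed_segment 0 d"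
      have "((\<lambda>y. f (x0 + (u + y))) has_derivative blinfun_apply (D (x0 + (u + y)))) (at y within closed_segment 0 d)" for u
        by (rule has_derivative_compose[of "\<lambda>y. x0 + (u + y)" "\<lambda>h. h", OF _ D]) (auto intro!: derivative_eq_intros)
      from has_derivative_diff[OF this[of p] this[of q]]
      show "(\<phi> has_derivative blinfun_apply (D (x0 + (p + y)) - D (x0 + (q + y)))) (at y within closed_segment 0 d)"
        unfolding \<phi>_def by (simp add: blinfun.diff_left[abs_def])
      obtain t where t: "y = t *\<^sub>R d" "0 \<le> t" "t \<le> 1" using y by (auto simp: in_segment)
      have "c * norm (p - q) \<le> c * (\<delta>' / 2)" using c(3)[of "p - q"] *(5) by simp
      then have "norm (p - q) < \<delta>'" using c(1) \<delta>'(1) by simp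
      then have "dist (D (x0 + (p + y))) (D (x0 + (q + y))) < \<epsilon>'"
        using t ball * by (intro \<delta>'(2) W) (auto simp: dist_norm)
      then show "onorm (blinfun_apply (D (x0 + (p + y)) - D (x0 + (q + y)))) \<le> \<epsilon>'"
        by (simp add: dist_norm norm_blinfun.rep_eq)
    qed auto
    then have "nrm (\<phi> d - \<phi> 0) \<le> C * (\<epsilon>' * norm d)"
      using order_trans[OF c(4) mult_left_mono[OF _ less_imp_le[OF c(2)]]] by simp
    also have "\<dots> = \<epsilon> * (c * norm d)" using c by (simp add: \<epsilon>'_def)
    also have "\<dots> \<le> \<epsilon> * nrm d" using c(3) \<epsilon> by (intro mult_left_mono) auto
    finally show "nrm (f (x0 + (p + d)) - f (x0 + p) - (f (x0 + (q + d)) - f (x0 + q))) \<le> \<epsilon> * nrm d"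
      by (simp add: \<phi>_def algebra_simps)
  qed
qed

text \<open>With \<open>d h = x h - x 0\<close> the shifted nonlinearity \<open>N h\<close> is \<open>N 0\<close> evaluated at the point moved by \<open>d h\<close>, plus
  \<open>T h - T 0\<close>, plus a constant. The constant cancels in increments, the second part is small in the
  Lipschitz norm, and the first is a double difference of \<open>N 0\<close>. The factor \<open>3\<close> leaves room for
  \<open>q' + (p - p')\<close>, the point that splits such a double difference into a pure change of the base point
  and a pure change of the increment.\<close>

lemma regular_shifted_family:
  fixes T :: "real \<Rightarrow> 'a \<Rightarrow> 'a" and x :: "real \<Rightarrow> 'a" and L :: "'a \<Rightarrow>\<^sub>L 'a" and R g :: real
  defines "N \<equiv> \<lambda>h z. T h (z + x h) - x h - blinfun_apply L z"
  assumes x: "((\<lambda>h. norm (x h - x 0)) \<longlongrightarrow> 0) (at_right 0)"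
    and T: "((\<lambda>h. lip_norm_on U (\<lambda>y. T h y - T 0 y)) \<longlongrightarrow> 0) (at_right 0)"
    and D: "\<And>y. (T 0 has_derivative blinfun_apply (D y)) (at y)" and uc: "uniformly_continuous_on W D"
    and U: "\<And>z. nrm z < 3 * R \<Longrightarrow> x 0 + z \<in> U" and W: "\<And>z. nrm z < 3 * R \<Longrightarrow> x 0 + z \<in> W"
    and R: "0 < R" and g: "0 \<le> g"
    and lip: "\<And>z w. nrm z < 3 * R \<Longrightarrow> nrm w < 3 * R \<Longrightarrow> nrm (N 0 z - N 0 w) \<le> g * nrm (z - w)"
  shows "regular_family nrm {z. nrm z < R} g N"
proof -
  define d where "d h = x h - x 0" for h
  define H where "H h y = T h y - T 0 y" for h y
  have "((\<lambda>h. nrm (d h)) \<longlongrightarrow> 0) (at_right 0)"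
    using x unfolding d_def by (simp flip: tendsto_iff_nrm add: tendsto_norm_zero_iff LIM_zero_iff)
  then have small: "\<forall>\<^sub>F h in at_right 0. nrm (d h) < \<epsilon>" if "0 < \<epsilon>" for \<epsilon>
    using that by (rule order_tendstoD)
  have H: "\<forall>\<^sub>F h in at_right 0. (\<forall>y\<in>U. nrm (H h y) \<le> \<epsilon>) \<and> 
      (\<forall>y\<in>U. \<forall>y'\<in>U. nrm (H h y - H h y') \<le> \<epsilon> * nrm (y - y'))" if "0 < \<epsilon>" for \<epsilon>
    using T that unfolding lip_norm_tendsto_0_iff H_def by blast
  have N: "N h z = H h (x 0 + (z + d h)) + N 0 (z + d h) + (blinfun_apply L (d h) - d h)" for h z
    by (simp add: N_def H_def d_def blinfun.add_right blinfun.diff_right algebra_simps)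
  have ball: "nrm (z + d h) < 2 * R" if "nrm z < R" "nrm (d h) < R" for z h
    using triangle[of z "d h"] that by linarith
  obtain \<Lambda> where \<Lambda>: "0 \<le> \<Lambda>" "\<And>x. nrm (blinfun_apply L x) \<le> \<Lambda> * nrm x"
    using blinfun_nrm_bound by blast
  show ?thesis unfolding regular_family_def
  proof (intro conjI allI impI)
    fix \<epsilon> :: real assume \<epsilon>: "0 < \<epsilon>"
    have "0 < \<epsilon> / 2 / (g + \<Lambda> + 1)" using \<epsilon> g \<Lambda> by simp
    from small[OF this] small[OF R] H[OF half_gt_zero[OF \<epsilon>]]
    show "\<forall>\<^sub>F h in at_right 0. \<forall>p\<in>{z. nrm z < R}. nrm (N h p - N 0 p) \<le> \<epsilon>"
    proof eventually_elim
      case (elim h)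
      have d: "(g + \<Lambda> + 1) * nrm (d h) \<le> \<epsilon> / 2"
        using elim(1) g \<Lambda>(1) by (subst (asm) pos_less_divide_eq) (auto simp: mult.commute)
      show ?case
      proof
        fix p assume "p \<in> {z. nrm z < R}"
        then have p: "nrm p < R" by simp
        have "N h p - N 0 p = H h (x 0 + (p + d h)) + (N 0 (p + d h) - N 0 p) + (blinfun_apply L (d h) - d h)"
          by (subst N) simp
        then have "nrm (N h p - N 0 p) \<le> nrm (H h (x 0 + (p + d h))) + nrm (N 0 (p + d h) - N 0 p) 
            + (nrm (blinfun_apply L (d h)) + nrm (d h))"
          by (smt (verit) triangle triangle_diff)
        also have "\<dots> \<le> \<epsilon> / 2 + g * nrm (d h) + (\<Lambda> * nrm (d h) + nrm (d h))"
        proof (intro add_mono order_refl \<Lambda>(2))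
          have b: "nrm (p + d h) < 3 * R" "nrm p < 3 * R" using ball[OF p elim(2)] p R by simp_all
          show "nrm (H h (x 0 + (p + d h))) \<le> \<epsilon> / 2" using elim(3) U[OF b(1)] by blast
          show "nrm (N 0 (p + d h) - N 0 p) \<le> g * nrm (d h)" using lip[OF b] by simp
        qed
        also have "\<dots> = \<epsilon> / 2 + (g + \<Lambda> + 1) * nrm (d h)" by (simp add: algebra_simps)
        finally show "nrm (N h p - N 0 p) \<le> \<epsilon>" using d by linarith
      qed
    qed
    obtain \<delta> where \<delta>: "0 < \<delta>" "\<And>p q d. \<lbrakk>nrm p < 3 * R; nrm (p + d) < 3 * R; nrm q < 3 * R; nrm (q + d) < 3 * R; nrm (p - q) \<le> \<delta>\<rbrakk> \<Longrightarrow>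
      nrm (T 0 (x 0 + (p + d)) - T 0 (x 0 + p) - (T 0 (x 0 + (q + d)) - T 0 (x 0 + q))) \<le> \<epsilon> / 2 * nrm d"
      using derivative_double_difference[OF D uc W half_gt_zero[OF \<epsilon>]] by blast
    have "\<forall>\<^sub>F h in at_right 0. \<forall>p\<in>{z. nrm z < R}. \<forall>p'\<in>{z. nrm z < R}. \<forall>q\<in>{z. nrm z < R}. \<forall>q'\<in>{z. nrm z < R}.
        nrm (p - q) \<le> \<delta> / 2 \<longrightarrow> nrm (p' - q') \<le> \<delta> / 2 \<longrightarrow>
        nrm (N h p - N h p' - (N 0 q - N 0 q')) \<le> g * nrm (p - p' - (q - q')) + \<epsilon> * nrm (p - p')"
      using small[OF half_gt_zero[OF \<delta>(1)]] small[OF R] H[OF half_gt_zero[OF \<epsilon>]]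
    proof eventually_elim
      case (elim h)
      show ?case
      proof (intro ballI impI)
        fix p p' q q'
        assume "p \<in> {z. nrm z < R}" "p' \<in> {z. nrm z < R}" "q \<in> {z. nrm z < R}" "q' \<in> {z. nrm z < R}"
        then have b: "nrm p < R" "nrm p' < R" "nrm q < R" "nrm q' < R" by auto
        assume "nrm (p - q) \<le> \<delta> / 2" and pq': "nrm (p' - q') \<le> \<delta> / 2"
        let ?e = "p - p'"
        have bp: "nrm (p + d h) < 3 * R" "nrm (p' + d h) < 3 * R" 
          using ball[OF b(1) elim(2)] ball[OF b(2) elim(2)] R by simp_all
        have bq: "nrm (q' + ?e) < 3 * R" "nrm q < 3 * R" "nrm q' < 3 * R"
          using triangle[of q' "?e"] triangle_diff[of p p'] b R by linarith+
        have sm: "nrm (p' + d h - q') \<le> \<delta>"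
          using triangle[of "p' - q'" "d h"] pq' elim(1) by (simp add: algebra_simps)
        have h1: "nrm (H h (x 0 + (p + d h)) - H h (x 0 + (p' + d h))) \<le> \<epsilon> / 2 * nrm ?e"
        proof -
          have "nrm (H h (x 0 + (p + d h)) - H h (x 0 + (p' + d h))) 
              \<le> \<epsilon> / 2 * nrm (x 0 + (p + d h) - (x 0 + (p' + d h)))"
            using elim(3) U[OF bp(1)] U[OF bp(2)] by blast
          then show ?thesis by simp
        qed
        \<comment> \<open>equal increments, so the linear parts cancel and only the derivative of \<open>T 0\<close> matters\<close>
        have h2: "nrm (N 0 (p + d h) - N 0 (p' + d h) - (N 0 (q' + ?e) - N 0 q')) \<le> \<epsilon> / 2 * nrm ?e"
        proof -
          have e: "p' + d h + ?e = p + d h" by simp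
          have "nrm (T 0 (x 0 + (p + d h)) - T 0 (x 0 + (p' + d h)) - (T 0 (x 0 + (q' + ?e)) - T 0 (x 0 + q'))) \<le> \<epsilon> / 2 * nrm ?e"
            using \<delta>(2)[OF bp(2) _ bq(3,1) sm, unfolded e, OF bp(1)] .
          then show ?thesis 
            by (simp add: N_def blinfun.add_right blinfun.diff_right algebra_simps)
        qed
        have h3: "nrm (N 0 (q' + ?e) - N 0 q) \<le> g * nrm (p - p' - (q - q'))"
          using lip[OF bq(1,2)] by (simp add: algebra_simps)
        have "N h p - N h p' - (N 0 q - N 0 q') = (H h (x 0 + (p + d h)) - H h (x 0 + (p' + d h)))
           + (N 0 (p + d h) - N 0 (p' + d h) - (N 0 (q' + ?e) - N 0 q')) + (N 0 (q' + ?e) - N 0 q)"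
          by (subst (1 2) N) simp
        then have "nrm (N h p - N h p' - (N 0 q - N 0 q')) \<le> \<epsilon> / 2 * nrm ?e + \<epsilon> / 2 * nrm ?e + g * nrm (p - p' - (q - q'))"
          using h1 h2 h3 by (smt (verit) triangle)
        then show "nrm (N h p - N h p' - (N 0 q - N 0 q')) \<le> g * nrm (p - p' - (q - q')) + \<epsilon> * nrm ?e"
          by simp
      qed
    qed
    then show "\<exists>\<delta>>0. \<forall>\<^sub>F h in at_right 0. \<forall>p\<in>{z. nrm z < R}. \<forall>p'\<in>{z. nrm z < R}. \<forall>q\<in>{z. nrm z < R}. \<forall>q'\<in>{z. nrm z < R}.
        nrm (p - q) \<le> \<delta> \<longrightarrow> nrm (p' - q') \<le> \<delta> \<longrightarrow>
        nrm (N h p - N h p' - (N 0 q - N 0 q')) \<le> g * nrm (p - p' - (q - q')) + \<epsilon> * nrm (p - p')"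
      using half_gt_zero[OF \<delta>(1)] by blast
  qed
qed

end

section \<open>A boundary value problem on the half-line\<close>

text \<open>The supremum \<open>E\<close> of the sequence satisfies \<open>E \<le> max c0 (k * E + c)\<close>; boundedness is what makes \<open>E\<close>
  finite, so that \<open>k * E\<close> can be absorbed.\<close>

lemma discrete_dichotomy_bound:
  fixes a :: "nat \<Rightarrow> real"
  assumes bdd: "\<And>n. a n \<le> M" and k: "0 \<le> k" "k < 1" and c: "0 \<le> c"
    and zero: "a 0 \<le> max c0 (k * max (a 0) (a 1) + c)"
    and Suc: "\<And>n. a (Suc n) \<le> max (k * max (a n) (a (Suc n)) + c)
                                       (k * max (a (Suc n)) (a (Suc (Suc n))) + c)"
  shows "a n \<le> max c0 (c / (1 - k))"
proof -
  define E where "E = (SUP n. a n)"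
  have bd: "bdd_above (range a)" using bdd unfolding bdd_above_def by blast
  have le: "a n \<le> E" for n unfolding E_def by (rule cSUP_upper[OF _ bd]) simp
  have kE: "k * max (a i) (a j) + c \<le> k * E + c" for i j
    using le k by (simp add: mult_left_mono)
  have "a n \<le> max c0 (k * E + c)" for n
  proof (cases n)
    case 0 with zero kE[of 0 1] show ?thesis by auto
  next
    case (Suc m) with assms(6)[of m] kE[of m "Suc m"] kE[of "Suc m" "Suc (Suc m)"] 
    show ?thesis by auto
  qed
  then have E: "E \<le> max c0 (k * E + c)" unfolding E_def by (intro cSUP_least) auto
  have "E \<le> max c0 (c / (1 - k))"
  proof (cases "E \<le> c0")
    case False
    with E have "E \<le> k * E + c" by auto
    then have "E \<le> c / (1 - k)" using k by (simp add: field_simps)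
    then show ?thesis by simp
  qed simp
  with le show ?thesis by (meson order_trans)
qed

context adapted_norm
begin

definition pair_nrm :: "'a \<times> 'a \<Rightarrow> real" where
  "pair_nrm w = max (nrm (fst w)) (nrm (snd w))"

lemma pair_nrm_simps [simp]: "pair_nrm (u, v) = max (nrm u) (nrm v)"
  by (simp add: pair_nrm_def)

lemma pair_nrm_nonneg [simp]: "0 \<le> pair_nrm w"
  by (simp add: pair_nrm_def le_max_iff_disj)

end

text \<open>\<open>SG\<close> contains the component that is prescribed at time \<open>0\<close> and \<open>SF\<close> the free one. For the stable
  manifold \<open>SG\<close> is the stable subspace; for the unstable one the roles are exchanged.\<close>

locale split_norm = adapted_norm nrm for nrm :: "'a::banach \<Rightarrow> real" +
  fixes SG SF :: "'a set"
  assumes subspace_G: "subspace SG" and subspace_F: "subspace SF"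
    and max_norm: "v \<in> SG \<Longrightarrow> w \<in> SF \<Longrightarrow> nrm (v + w) = max (nrm v) (nrm w)"
begin

text \<open>The boundary value problem: the component in \<open>SG\<close> starts from \<open>\<xi>\<close> and is propagated by \<open>G\<close>, the
  component in \<open>SF\<close> is determined by \<open>F\<close> from the next term. Time is the index \<open>n\<close> for forward orbits
  and \<open>-n\<close> for backward orbits, which is why both \<open>F\<close> and \<open>G\<close> see two consecutive terms.\<close>

definition sol :: "('a \<times> 'a \<Rightarrow> 'a) \<Rightarrow> ('a \<times> 'a \<Rightarrow> 'a) \<Rightarrow> 'a \<Rightarrow> (nat \<Rightarrow> 'a) \<Rightarrow> bool" where
  "sol F G \<xi> z \<longleftrightarrow> z 0 = \<xi> + F (z 0, z 1) \<and>
     (\<forall>n. z (Suc n) = G (z n, z (Suc n)) + F (z (Suc n), z (Suc (Suc n))))"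

definition contracting :: "real \<Rightarrow> real \<Rightarrow> ('a \<times> 'a \<Rightarrow> 'a) \<Rightarrow> ('a \<times> 'a \<Rightarrow> 'a) \<Rightarrow> bool" where
  "contracting k r F G \<longleftrightarrow> range F \<subseteq> SF \<and> range G \<subseteq> SG \<and> F (0, 0) = 0 \<and> G (0, 0) = 0 \<and>
     (\<forall>p q. pair_nrm p < r \<longrightarrow> pair_nrm q < r \<longrightarrow>
        nrm (F p - F q) \<le> k * pair_nrm (p - q) \<and> nrm (G p - G q) \<le> k * pair_nrm (p - q))"

lemma contractingD:
  assumes "contracting k r F G"
  shows "F p \<in> SF" "G p \<in> SG" "F (0, 0) = 0" "G (0, 0) = 0"
  using assms unfolding contracting_def by blast+

lemma contracting_lipschitz:
  assumes "contracting k r F G" "pair_nrm p < r" "pair_nrm q < r"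
  shows "nrm (F p - F q) \<le> k * pair_nrm (p - q)" "nrm (G p - G q) \<le> k * pair_nrm (p - q)"
  using assms unfolding contracting_def by blast+

definition orbit :: "real \<Rightarrow> ('a \<times> 'a \<Rightarrow> 'a) \<Rightarrow> ('a \<times> 'a \<Rightarrow> 'a) \<Rightarrow> 'a \<Rightarrow> nat \<Rightarrow> 'a" where
  "orbit r F G \<xi> = (SOME z. sol F G \<xi> z \<and> (\<forall>n. nrm (z n) < r))"

text \<open>The free component at time \<open>0\<close> of the solution with prescribed component \<open>\<xi>\<close>.\<close>

definition graph_map :: "real \<Rightarrow> ('a \<times> 'a \<Rightarrow> 'a) \<Rightarrow> ('a \<times> 'a \<Rightarrow> 'a) \<Rightarrow> 'a \<Rightarrow> 'a" where
  "graph_map r F G \<xi> = F (orbit r F G \<xi> 0, orbit r F G \<xi> 1)"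

context
  fixes k r :: real
  assumes k: "0 \<le> k" "k < 1" and r: "0 < r"
begin

text \<open>By the maximum norm, the difference of two solutions is estimated separately in its two
  components, and \<open>discrete_dichotomy_bound\<close> applies. The perturbation of \<open>F\<close> and \<open>G\<close> enters as \<open>c\<close>.\<close>

lemma sol_difference_bound:
  assumes z: "\<And>n. nrm (z n) < r" "sol F G \<xi> z" and w: "\<And>n. nrm (w n) < r" "sol F' G' \<xi>' w"
    and F: "contracting k r F G" and F': "contracting k r F' G'" and in_G: "\<xi> \<in> SG" "\<xi>' \<in> SG"
    and c: "0 \<le> c"
      "\<And>p. pair_nrm p < r \<Longrightarrow> nrm (F p - F' p) \<le> c"
      "\<And>p. pair_nrm p < r \<Longrightarrow> nrm (G p - G' p) \<le> c"
  shows "nrm (z n - w n) \<le> max (nrm (\<xi> - \<xi>')) (c / (1 - k))"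
proof (rule discrete_dichotomy_bound[where M = "2 * r" and k = k])
  show "nrm (z n - w n) \<le> 2 * r" for n
    using triangle_diff[of "z n" "w n"] z(1)[of n] w(1)[of n] by simp
  have lip: "nrm (F' p - F' q) \<le> k * pair_nrm (p - q)" "nrm (G' p - G' q) \<le> k * pair_nrm (p - q)"
    if "pair_nrm p < r" "pair_nrm q < r" for p q by (rule contracting_lipschitz[OF F' that])+
  have le: "nrm (F (z i, z j) - F' (w i, w j)) \<le> k * max (nrm (z i - w i)) (nrm (z j - w j)) + c"
      "nrm (G (z i, z j) - G' (w i, w j)) \<le> k * max (nrm (z i - w i)) (nrm (z j - w j)) + c" for i j
  proof -
    have *: "pair_nrm (z i, z j) < r" "pair_nrm (w i, w j) < r" using z(1) w(1) by auto
    show "nrm (F (z i, z j) - F' (w i, w j)) \<le> k * max (nrm (z i - w i)) (nrm (z j - w j)) + c"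
      using triangle[of "F (z i, z j) - F' (z i, z j)" "F' (z i, z j) - F' (w i, w j)"]
        c(2)[OF *(1)] lip(1)[OF *] by simp
    show "nrm (G (z i, z j) - G' (w i, w j)) \<le> k * max (nrm (z i - w i)) (nrm (z j - w j)) + c"
      using triangle[of "G (z i, z j) - G' (z i, z j)" "G' (z i, z j) - G' (w i, w j)"]
        c(3)[OF *(1)] lip(2)[OF *] by simp
  qed
  have in_SF: "F p - F' q \<in> SF" and in_SG: "G p - G' q \<in> SG" for p q
    by (rule subspace_diff[OF subspace_F] subspace_diff[OF subspace_G] contractingD[OF F] contractingD[OF F'])+
  have "z 0 - w 0 = (\<xi> - \<xi>') + (F (z 0, z 1) - F' (w 0, w 1))"
  proof -
    have "z 0 = \<xi> + F (z 0, z 1)" "w 0 = \<xi>' + F' (w 0, w 1)" using z(2) w(2) by (simp_all add: sol_def)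
    then show ?thesis by (metis add_diff_add)
  qed
  then have "nrm (z 0 - w 0) = max (nrm (\<xi> - \<xi>')) (nrm (F (z 0, z 1) - F' (w 0, w 1)))"
    using max_norm in_SF in_G subspace_diff[OF subspace_G] by simp
  then show "nrm (z 0 - w 0) \<le> max (nrm (\<xi> - \<xi>')) (k * max (nrm (z 0 - w 0)) (nrm (z 1 - w 1)) + c)"
    by (rule ord_eq_le_trans[OF _ max.mono[OF order_refl le(1)]])
  fix n
  have "z (Suc n) - w (Suc n) = (G (z n, z (Suc n)) - G' (w n, w (Suc n)))
      + (F (z (Suc n), z (Suc (Suc n))) - F' (w (Suc n), w (Suc (Suc n))))"
  proof -
    have "z (Suc n) = G (z n, z (Suc n)) + F (z (Suc n), z (Suc (Suc n)))" 
      "w (Suc n) = G' (w n, w (Suc n)) + F' (w (Suc n), w (Suc (Suc n)))"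
      using z(2) w(2) by (simp_all add: sol_def)
    then show ?thesis by (metis add_diff_add)
  qed
  then have "nrm (z (Suc n) - w (Suc n)) = max (nrm (G (z n, z (Suc n)) - G' (w n, w (Suc n))))
      (nrm (F (z (Suc n), z (Suc (Suc n))) - F' (w (Suc n), w (Suc (Suc n)))))"
    using max_norm in_SF in_SG by metis
  then show "nrm (z (Suc n) - w (Suc n)) \<le> 
      max (k * max (nrm (z n - w n)) (nrm (z (Suc n) - w (Suc n))) + c)
         (k * max (nrm (z (Suc n) - w (Suc n))) (nrm (z (Suc (Suc n)) - w (Suc (Suc n)))) + c)"
    by (rule ord_eq_le_trans[OF _ max.mono[OF le(2) le(1)]])
qed (use k c in auto)

lemma sol_lipschitz:
  assumes "\<And>n. nrm (z n) < r" "sol F G \<xi> z" "\<And>n. nrm (w n) < r" "sol F G \<xi>' w"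
    and "contracting k r F G" "\<xi> \<in> SG" "\<xi>' \<in> SG"
  shows "nrm (z n - w n) \<le> nrm (\<xi> - \<xi>')"
  using sol_difference_bound[OF assms(1-4) assms(5,5) assms(6,7), of 0] by simp

lemma sol_0: "contracting k r F G \<Longrightarrow> sol F G 0 (\<lambda>_. 0)"
  by (simp add: sol_def contractingD)

lemma sol_bound:
  assumes "\<And>n. nrm (z n) < r" "sol F G \<xi> z" "contracting k r F G" "\<xi> \<in> SG"
  shows "nrm (z n) \<le> nrm \<xi>"
  using sol_lipschitz[OF assms(1,2) _ sol_0 assms(3,4)] assms(3) r subspace_0[OF subspace_G] by simp

text \<open>A tail of a solution is again a solution, whose prescribed component is a value of \<open>G\<close>. Comparison
  with the zero solution bounds the whole tail by that value, hence by \<open>k\<close> times the size of the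
  previous tail.\<close>

lemma sol_decay:
  assumes z: "\<And>n. nrm (z n) < r" "sol F G \<xi> z" and F: "contracting k r F G" and "\<xi> \<in> SG"
  shows "nrm (z n) \<le> k ^ n * nrm \<xi>"
proof -
  have "nrm (z (n + m)) \<le> k ^ n * nrm \<xi>" for m
  proof (induction n arbitrary: m)
    case 0
    then show ?case using sol_bound[OF assms] by simp
  next
    case (Suc n)
    let ?\<zeta> = "G (z n, z (Suc n))"
    have "sol F G ?\<zeta> (\<lambda>m. z (Suc n + m))"
      using z(2) by (simp add: sol_def)
    moreover have "?\<zeta> \<in> SG" by (rule contractingD[OF F])
    ultimately have "nrm (z (Suc n + m)) \<le> nrm ?\<zeta>"
      using sol_bound[of "\<lambda>m. z (Suc n + m)" F G ?\<zeta> m] z(1) F by simp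
    also have "\<dots> \<le> k * max (nrm (z n)) (nrm (z (Suc n)))"
    proof -
      have "nrm (G (z n, z (Suc n)) - G (0, 0)) \<le> k * pair_nrm ((z n, z (Suc n)) - (0, 0))"
        by (rule contracting_lipschitz(2)[OF F]) (simp_all add: z(1) r)
      then show ?thesis by (simp add: contractingD[OF F])
    qed
    also have "\<dots> \<le> k * (k ^ n * nrm \<xi>)"
      using Suc.IH[of 0] Suc.IH[of 1] k by (intro mult_left_mono) auto
    finally show ?case by (simp add: mult.assoc)
  qed
  from this[of 0] show ?thesis by simp
qed

text \<open>Successive approximation starting from the zero sequence. Every approximation stays in the ball of
  radius \<open>nrm \<xi>\<close>, so that the contraction estimates on the ball of radius \<open>r\<close> apply to it.\<close>

lemma sol_exists:
  assumes F: "contracting k r F G" and \<xi>: "\<xi> \<in> SG" "nrm \<xi> < r"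
  obtains z where "sol F G \<xi> z" "\<And>n. nrm (z n) < r"
proof -
  define step where "step z n = (case n of 0 \<Rightarrow> \<xi> + F (z 0, z 1)
      | Suc m \<Rightarrow> G (z m, z n) + F (z n, z (Suc n)))" for z :: "nat \<Rightarrow> 'a" and n
  define Z where "Z j = (step ^^ j) (\<lambda>_. 0)" for j
  have Z0: "Z 0 n = 0" and ZS: "Z (Suc j) = step (Z j)" for j n by (simp_all add: Z_def)
  have in_S: "F p \<in> SF" "G p \<in> SG" for p by (rule contractingD[OF F])+
  have lip: "nrm (F p - F q) \<le> k * pair_nrm (p - q)" "nrm (G p - G q) \<le> k * pair_nrm (p - q)"
    if "pair_nrm p < r" "pair_nrm q < r" for p q by (rule contracting_lipschitz[OF F that])+
  have lip0: "nrm (F p) \<le> k * pair_nrm p" "nrm (G p) \<le> k * pair_nrm p"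
    if "pair_nrm p < r" for p 
    using lip[OF that, of "(0, 0)"] r by (simp_all add: contractingD[OF F] pair_nrm_def)
  have Zb: "nrm (Z j n) \<le> nrm \<xi>" for j n
  proof (induction j arbitrary: n)
    case (Suc j)
    have Zr: "pair_nrm (Z j m, Z j m') < r" for m m' using Suc[of m] Suc[of m'] \<xi>(2) by simp
    have "k * pair_nrm (Z j m, Z j m') \<le> 1 * nrm \<xi>" for m m'
      using Suc[of m] Suc[of m'] k by (intro mult_mono) (auto simp: le_max_iff_disj)
    then have "nrm (F (Z j m, Z j m')) \<le> nrm \<xi>" "nrm (G (Z j m, Z j m')) \<le> nrm \<xi>" for m m'
      using lip0[OF Zr, of m m'] by (metis mult_1 order_trans)+
    then show ?case
      by (cases n) (simp_all add: ZS step_def max_norm in_S \<xi>)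
  qed (simp add: Z0)
  have Zr: "pair_nrm (Z j m, Z j m') < r" for j m m' using Zb[of j m] Zb[of j m'] \<xi>(2) by simp
  have Zd: "nrm (Z (Suc j) n - Z j n) \<le> k ^ j * nrm \<xi>" for j n
  proof (induction j arbitrary: n)
    case 0
    then show ?case using Zb[of 1 n] by (simp add: Z0)
  next
    case (Suc j)
    have *: "k * pair_nrm ((Z (Suc j) m, Z (Suc j) m') - (Z j m, Z j m')) \<le> k * (k ^ j * nrm \<xi>)" for m m'
      using Suc[of m] Suc[of m'] k by (intro mult_left_mono) auto
    have le: "nrm (F (Z (Suc j) m, Z (Suc j) m') - F (Z j m, Z j m')) \<le> k ^ Suc j * nrm \<xi>"
        "nrm (G (Z (Suc j) m, Z (Suc j) m') - G (Z j m, Z j m')) \<le> k ^ Suc j * nrm \<xi>" for m m'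
      unfolding power_Suc mult.assoc by (rule order_trans[OF lip(1)[OF Zr Zr] *] order_trans[OF lip(2)[OF Zr Zr] *])+
    show ?case
    proof (cases n)
      case 0
      have "Z (Suc (Suc j)) 0 - Z (Suc j) 0 = F (Z (Suc j) 0, Z (Suc j) 1) - F (Z j 0, Z j 1)"
        by (subst (1 2) ZS) (simp add: step_def)
      with le 0 show ?thesis by metis
    next
      case (Suc m)
      have "Z (Suc (Suc j)) n - Z (Suc j) n = 
          (G (Z (Suc j) m, Z (Suc j) n) - G (Z j m, Z j n)) +
          (F (Z (Suc j) n, Z (Suc j) (Suc n)) - F (Z j n, Z j (Suc n)))"
        by (subst (1 2) ZS) (simp add: step_def Suc)
      with le show ?thesis
        by (simp add: max_norm in_S subspace_diff[OF subspace_F] subspace_diff[OF subspace_G])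
    qed
  qed
  have "convergent (\<lambda>j. Z j n)" for n by (rule convergent_geometric[OF Zd k])
  then have "\<exists>z. \<forall>n. (\<lambda>j. Z j n) \<longlonglongrightarrow> z n" unfolding convergent_def by metis
  then obtain z where z: "\<And>n. (\<lambda>j. Z j n) \<longlonglongrightarrow> z n" by auto
  have zb: "nrm (z n) \<le> nrm \<xi>" for n
  proof -
    have "isCont nrm (z n)" using continuous_nrm by (simp add: continuous_on_eq_continuous_at)
    then have "(\<lambda>j. nrm (Z j n)) \<longlonglongrightarrow> nrm (z n)" using z by (rule isCont_tendsto_compose)
    then show ?thesis by (rule LIMSEQ_le_const2) (use Zb in auto)
  qed
  have zr: "pair_nrm (z m, z m') < r" for m m' using zb[of m] zb[of m'] \<xi>(2) by simp
  have limF: "(\<lambda>j. F (Z j m, Z j m')) \<longlonglongrightarrow> F (z m, z m')"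
    and limG: "(\<lambda>j. G (Z j m, Z j m')) \<longlonglongrightarrow> G (z m, z m')" for m m'
  proof -
    have 1: "(\<lambda>j. pair_nrm ((Z j m, Z j m') - (z m, z m'))) \<longlonglongrightarrow> 0"
      using tendsto_max[OF z[of m, unfolded tendsto_iff_nrm[of _ "z m"]] z[of m', unfolded tendsto_iff_nrm[of _ "z m'"]]]
      by simp
    show "(\<lambda>j. F (Z j m, Z j m')) \<longlonglongrightarrow> F (z m, z m')"
      unfolding tendsto_iff_nrm[of _ "F (z m, z m')"]
      by (rule tendsto_0_le[OF 1, where K = k]) (use lip(1)[OF Zr zr] in \<open>auto simp: mult.commute abs_of_nonneg le_max_iff_disj\<close>)
    show "(\<lambda>j. G (Z j m, Z j m')) \<longlonglongrightarrow> G (z m, z m')"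
      unfolding tendsto_iff_nrm[of _ "G (z m, z m')"]
      by (rule tendsto_0_le[OF 1, where K = k]) (use lip(2)[OF Zr zr] in \<open>auto simp: mult.commute abs_of_nonneg le_max_iff_disj\<close>)
  qed
  have "sol F G \<xi> z" unfolding sol_def
  proof (intro conjI allI)
    have "(\<lambda>j. Z (Suc j) 0) \<longlonglongrightarrow> \<xi> + F (z 0, z 1)"
      unfolding ZS step_def by (simp, intro tendsto_intros limF[of 0 1, simplified])
    with LIMSEQ_Suc[OF z[of 0]] show "z 0 = \<xi> + F (z 0, z 1)" by (rule LIMSEQ_unique)
    fix n
    have "(\<lambda>j. Z (Suc j) (Suc n)) \<longlonglongrightarrow> G (z n, z (Suc n)) + F (z (Suc n), z (Suc (Suc n)))"
      unfolding ZS step_def by (simp, intro tendsto_intros limF limG)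
    with LIMSEQ_Suc[OF z[of "Suc n"]] show "z (Suc n) = G (z n, z (Suc n)) + F (z (Suc n), z (Suc (Suc n)))" 
      by (rule LIMSEQ_unique)
  qed
  then show ?thesis using that zb \<xi>(2) by (meson le_less_trans)
qed

lemma orbit:
  assumes "contracting k r F G" "\<xi> \<in> SG" "nrm \<xi> < r"
  shows "sol F G \<xi> (orbit r F G \<xi>)" "nrm (orbit r F G \<xi> n) < r"
proof -
  have "\<exists>z. sol F G \<xi> z \<and> (\<forall>n. nrm (z n) < r)" using sol_exists[OF assms] by blast
  from someI_ex[OF this] show "sol F G \<xi> (orbit r F G \<xi>)" "nrm (orbit r F G \<xi> n) < r"
    by (auto simp: orbit_def)
qed

lemma orbit_unique:
  assumes "contracting k r F G" "\<xi> \<in> SG" "nrm \<xi> < r" "sol F G \<xi> z" "\<And>n. nrm (z n) < r"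
  shows "z = orbit r F G \<xi>"
proof
  fix n show "z n = orbit r F G \<xi> n"
    using sol_lipschitz[OF assms(5,4) orbit(2,1) assms(1), of \<xi> n] assms
      nrm_nonneg[of "z n - orbit r F G \<xi> n"] by (simp del: nrm_nonneg add: order_antisym_conv)
qed

lemma orbit_0: 
  assumes "contracting k r F G" "\<xi> \<in> SG" "nrm \<xi> < r"
  shows "orbit r F G \<xi> 0 = \<xi> + graph_map r F G \<xi>"
  using orbit(1)[OF assms] by (simp add: graph_map_def sol_def)

text \<open>The first bound is \<open>sol_difference_bound\<close>. For the second one, the double difference of the orbits
  has zero prescribed component, and \<open>discrete_dichotomy_bound\<close> applies to it: the four-point estimate, applicable
  because the orbits are uniformly close by the first bound, has error \<open>c * nrm (\<xi> - \<xi>')\<close> since solutions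
  are Lipschitz in the prescribed component.\<close>

lemma orbit_family:
  fixes F G :: "real \<Rightarrow> 'a \<times> 'a \<Rightarrow> 'a"
  assumes C: "\<And>h. h \<in> {0..h0} \<Longrightarrow> contracting k r (F h) (G h)" and h0: "h0 > 0"
    and F: "regular_family pair_nrm {p. pair_nrm p < r} k F"
    and G: "regular_family pair_nrm {p. pair_nrm p < r} k G"
    and \<epsilon>: "\<epsilon> > 0"
  shows "\<forall>\<^sub>F h in at_right 0. \<forall>\<xi>\<in>{\<xi>\<in>SG. nrm \<xi> < r}. \<forall>\<xi>'\<in>{\<xi>\<in>SG. nrm \<xi> < r}. \<forall>n.
     nrm (orbit r (F h) (G h) \<xi> n - orbit r (F 0) (G 0) \<xi> n) \<le> \<epsilon> \<and>
     nrm (orbit r (F h) (G h) \<xi> n - orbit r (F h) (G h) \<xi>' n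
        - (orbit r (F 0) (G 0) \<xi> n - orbit r (F 0) (G 0) \<xi>' n)) \<le> \<epsilon> * nrm (\<xi> - \<xi>')"
proof -
  let ?B = "{p. pair_nrm p < r}"
  define c where "c = \<epsilon> * (1 - k)"
  have c: "c > 0" "c / (1 - k) = \<epsilon>" using \<epsilon> k by (auto simp: c_def)
  let ?dd = "\<lambda>f \<delta> h. \<forall>p\<in>?B. \<forall>p'\<in>?B. \<forall>q\<in>?B. \<forall>q'\<in>?B.
        pair_nrm (p - q) \<le> \<delta> \<longrightarrow> pair_nrm (p' - q') \<le> \<delta> \<longrightarrow>
        nrm (f h p - f h p' - (f 0 q - f 0 q')) \<le> k * pair_nrm (p - p' - (q - q')) + c * pair_nrm (p - p')"
  obtain \<delta>F where \<delta>F: "\<delta>F > 0" "\<forall>\<^sub>F h in at_right 0. ?dd F \<delta>F h"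
    using regular_family_double_difference[OF F c(1)] by blast
  obtain \<delta>G where \<delta>G: "\<delta>G > 0" "\<forall>\<^sub>F h in at_right 0. ?dd G \<delta>G h"
    using regular_family_double_difference[OF G c(1)] by blast
  define \<delta> where "\<delta> = min \<epsilon> (min \<delta>F \<delta>G)"
  have \<delta>: "\<delta> > 0" using \<epsilon> \<delta>F \<delta>G by (simp add: \<delta>_def)
  \<comment> \<open>orbits of perturbations of size \<open>d\<close> are \<open>\<delta>\<close>-close\<close>
  define d where "d = \<delta> * (1 - k)"
  have d: "d > 0" "d / (1 - k) = \<delta>" using \<delta> k by (auto simp: d_def)
  have "\<forall>\<^sub>F h in at_right 0. \<forall>p\<in>?B. nrm (F h p - F 0 p) \<le> d" 
       "\<forall>\<^sub>F h in at_right 0. \<forall>p\<in>?B. nrm (G h p - G 0 p) \<le> d" 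
    by (rule regular_family_tendsto[OF F d(1)] regular_family_tendsto[OF G d(1)])+
  moreover have "\<forall>\<^sub>F h in at_right 0. h \<in> {0..h0}"
    by (rule eventually_at_right_0_Icc[OF h0])
  ultimately show ?thesis using \<delta>F(2) \<delta>G(2)
  proof eventually_elim
    case (elim h)
    have Ch: "contracting k r (F h) (G h)" and C0: "contracting k r (F 0) (G 0)" using C elim(3) h0 by auto
    have close: "nrm (orbit r (F h) (G h) \<xi> n - orbit r (F 0) (G 0) \<xi> n) \<le> \<delta>" 
      if "\<xi> \<in> SG" "nrm \<xi> < r" for \<xi> n
      using sol_difference_bound[OF orbit(2,1)[OF Ch that] orbit(2,1)[OF C0 that] Ch C0 that(1,1), of d n]
        elim(1,2) d \<delta> by simp
    show ?case
    proof (intro ballI allI conjI)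
      fix \<xi> \<xi>' n assume "\<xi> \<in> {\<xi>\<in>SG. nrm \<xi> < r}" "\<xi>' \<in> {\<xi>\<in>SG. nrm \<xi> < r}"
      then have \<xi>: "\<xi> \<in> SG" "nrm \<xi> < r" and \<xi>': "\<xi>' \<in> SG" "nrm \<xi>' < r" by auto
      show "nrm (orbit r (F h) (G h) \<xi> n - orbit r (F 0) (G 0) \<xi> n) \<le> \<epsilon>"
        using close[OF \<xi>] by (rule order_trans) (simp add: \<delta>_def)
      define z z' w w' where defs: "z = orbit r (F h) (G h) \<xi>" "z' = orbit r (F h) (G h) \<xi>'"
        "w = orbit r (F 0) (G 0) \<xi>" "w' = orbit r (F 0) (G 0) \<xi>'"
      have b: "nrm (z n) < r" "nrm (z' n) < r" "nrm (w n) < r" "nrm (w' n) < r" for n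
        using orbit(2) Ch C0 \<xi> \<xi>' by (simp_all add: defs)
      have s: "sol (F h) (G h) \<xi> z" "sol (F h) (G h) \<xi>' z'" "sol (F 0) (G 0) \<xi> w" "sol (F 0) (G 0) \<xi>' w'"
        using orbit(1) Ch C0 \<xi> \<xi>' by (simp_all add: defs)
      have zz: "nrm (z n - z' n) \<le> nrm (\<xi> - \<xi>')" for n
        by (rule sol_lipschitz[OF b(1) s(1) b(2) s(2) Ch \<xi>(1) \<xi>'(1)])
      have cl: "nrm (z n - w n) \<le> \<delta>" "nrm (z' n - w' n) \<le> \<delta>" for n
        using close \<xi> \<xi>' by (simp_all add: defs)
      define e where "e n = z n - z' n - (w n - w' n)" for n
      let ?D = "\<lambda>f i j. f h (z i, z j) - f h (z' i, z' j) - (f 0 (w i, w j) - f 0 (w' i, w' j))"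
      have le: "nrm (?D f i j) \<le> k * max (nrm (e i)) (nrm (e j)) + c * nrm (\<xi> - \<xi>')"
        if "?dd f \<delta>' h" "\<delta> \<le> \<delta>'" for f \<delta>' i j
      proof -
        have "nrm (?D f i j) \<le> 
            k * pair_nrm ((z i, z j) - (z' i, z' j) - ((w i, w j) - (w' i, w' j))) 
            + c * pair_nrm ((z i, z j) - (z' i, z' j))"
          using that(1) b cl order_trans[OF _ that(2)] by simp
        moreover have "c * pair_nrm ((z i, z j) - (z' i, z' j)) \<le> c * nrm (\<xi> - \<xi>')"
          using zz c(1) by (intro mult_left_mono) auto
        ultimately show ?thesis by (simp add: e_def)
      qed
      have leF: "nrm (?D F i j) \<le> k * max (nrm (e i)) (nrm (e j)) + c * nrm (\<xi> - \<xi>')"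
        and leG: "nrm (?D G i j) \<le> k * max (nrm (e i)) (nrm (e j)) + c * nrm (\<xi> - \<xi>')" for i j
        using le[OF elim(4)] le[OF elim(5)] by (simp_all add: \<delta>_def)
      have in_S: "?D F i j \<in> SF" "?D G i j \<in> SG" for i j
        by (rule subspace_diff[OF subspace_F] subspace_diff[OF subspace_G]
            contractingD[OF Ch] contractingD[OF C0])+
      have "nrm (e n) \<le> max 0 (c * nrm (\<xi> - \<xi>') / (1 - k))"
      proof (rule discrete_dichotomy_bound[where M = "2 * \<delta>" and k = k])
        show "nrm (e n) \<le> 2 * \<delta>" for n
          using triangle_diff[of "z n - w n" "z' n - w' n"] cl[of n] by (simp add: e_def algebra_simps)
        have "e 0 = ?D F 0 1"
        proof -
          have "z 0 = \<xi> + F h (z 0, z 1)" "z' 0 = \<xi>' + F h (z' 0, z' 1)" 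
            "w 0 = \<xi> + F 0 (w 0, w 1)" "w' 0 = \<xi>' + F 0 (w' 0, w' 1)" using s by (simp_all add: sol_def)
          then have "e 0 = \<xi> + F h (z 0, z 1) - (\<xi>' + F h (z' 0, z' 1)) - 
            (\<xi> + F 0 (w 0, w 1) - (\<xi>' + F 0 (w' 0, w' 1)))" unfolding e_def by metis
          then show ?thesis by simp
        qed
        then show "nrm (e 0) \<le> max 0 (k * max (nrm (e 0)) (nrm (e 1)) + c * nrm (\<xi> - \<xi>'))"
          using leF[of 0 1] by (simp only: max.coboundedI2)
        fix n
        have "e (Suc n) = ?D G n (Suc n) + ?D F (Suc n) (Suc (Suc n))"
        proof -
          let ?x = "\<lambda>h z. G h (z n, z (Suc n)) + F h (z (Suc n), z (Suc (Suc n)))"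
          have "z (Suc n) = ?x h z" "z' (Suc n) = ?x h z'" "w (Suc n) = ?x 0 w" "w' (Suc n) = ?x 0 w'" 
            using s by (simp_all add: sol_def)
          then have "e (Suc n) = ?x h z - ?x h z' - (?x 0 w - ?x 0 w')" unfolding e_def by metis
          then show ?thesis by simp
        qed
        then have "nrm (e (Suc n)) = max (nrm (?D G n (Suc n))) (nrm (?D F (Suc n) (Suc (Suc n))))"
          using max_norm[OF in_S(2,1)] by metis
        then show "nrm (e (Suc n)) \<le> max (k * max (nrm (e n)) (nrm (e (Suc n))) + c * nrm (\<xi> - \<xi>'))
           (k * max (nrm (e (Suc n))) (nrm (e (Suc (Suc n)))) + c * nrm (\<xi> - \<xi>'))"
          by (rule ord_eq_le_trans[OF _ max.mono[OF leG leF]])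
      qed (use k c in auto)
      also have "\<dots> = \<epsilon> * nrm (\<xi> - \<xi>')" 
        using c(1) k by (subst c(2)[symmetric]) (simp add: max_def divide_le_0_iff mult_le_0_iff)
      finally show "nrm (orbit r (F h) (G h) \<xi> n - orbit r (F h) (G h) \<xi>' n
        - (orbit r (F 0) (G 0) \<xi> n - orbit r (F 0) (G 0) \<xi>' n)) \<le> \<epsilon> * nrm (\<xi> - \<xi>')"
        by (simp add: e_def defs)
    qed
  qed
qed

lemma graph_map_lipschitz:
  assumes C: "contracting k r F G" 
    and \<xi>: "\<xi> \<in> SG" "nrm \<xi> < r" "\<xi>' \<in> SG" "nrm \<xi>' < r"
  shows "nrm (graph_map r F G \<xi> - graph_map r F G \<xi>') \<le> nrm (\<xi> - \<xi>')"
proof -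
  note o = orbit[OF C]
  have "nrm (\<xi> - \<xi>' + (graph_map r F G \<xi> - graph_map r F G \<xi>')) \<le> nrm (\<xi> - \<xi>')"
    using sol_lipschitz[OF o(2)[OF \<xi>(1,2)] o(1)[OF \<xi>(1,2)] o(2)[OF \<xi>(3,4)] o(1)[OF \<xi>(3,4)] C \<xi>(1,3), of 0]
    by (simp add: orbit_0[OF C] \<xi> algebra_simps)
  moreover have "\<xi> - \<xi>' \<in> SG" "graph_map r F G \<xi> - graph_map r F G \<xi>' \<in> SF"
    using \<xi> contractingD[OF C] subspace_diff[OF subspace_G] subspace_diff[OF subspace_F]
    by (simp_all add: graph_map_def)
  ultimately show ?thesis using max_norm by simp
qed

lemma graph_map_family:
  fixes F G :: "real \<Rightarrow> 'a \<times> 'a \<Rightarrow> 'a"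
  assumes C: "\<And>h. h \<in> {0..h0} \<Longrightarrow> contracting k r (F h) (G h)" and h0: "h0 > 0"
    and F: "regular_family pair_nrm {p. pair_nrm p < r} k F"
    and G: "regular_family pair_nrm {p. pair_nrm p < r} k G"
  shows "lip_tendsto {\<xi> \<in> SG. nrm \<xi> < r} (\<lambda>h. graph_map r (F h) (G h))"
  unfolding lip_tendsto_def
proof (intro allI impI)
  fix \<epsilon> :: real assume \<epsilon>: "0 < \<epsilon>"
  let ?V = "{\<xi> \<in> SG. nrm \<xi> < r}"
  have "\<forall>\<^sub>F h in at_right 0. h \<in> {0..h0}"
    by (rule eventually_at_right_0_Icc[OF h0])
  moreover have "\<forall>\<^sub>F h in at_right 0. \<forall>\<xi>\<in>?V. \<forall>\<xi>'\<in>?V. \<forall>n.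
     nrm (orbit r (F h) (G h) \<xi> n - orbit r (F 0) (G 0) \<xi> n) \<le> \<epsilon> \<and>
     nrm (orbit r (F h) (G h) \<xi> n - orbit r (F h) (G h) \<xi>' n
        - (orbit r (F 0) (G 0) \<xi> n - orbit r (F 0) (G 0) \<xi>' n)) \<le> \<epsilon> * nrm (\<xi> - \<xi>')"
    by (rule orbit_family[OF C h0 F G \<epsilon>])
  ultimately
  show "\<forall>\<^sub>F h in at_right 0. (\<forall>\<xi>\<in>?V. nrm (graph_map r (F h) (G h) \<xi> - graph_map r (F 0) (G 0) \<xi>) \<le> \<epsilon>) \<and>
     (\<forall>\<xi>\<in>?V. \<forall>\<xi>'\<in>?V. nrm (graph_map r (F h) (G h) \<xi> - graph_map r (F 0) (G 0) \<xi> -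
        (graph_map r (F h) (G h) \<xi>' - graph_map r (F 0) (G 0) \<xi>')) \<le> \<epsilon> * nrm (\<xi> - \<xi>'))"
  proof eventually_elim
    case (elim h)
    have o: "orbit r (F h') (G h') \<xi> 0 = \<xi> + graph_map r (F h') (G h') \<xi>" if "\<xi> \<in> ?V" "h' \<in> {0, h}" for \<xi> h'
      using orbit_0[OF C, of h' \<xi>] that elim(1) h0 by auto
    show ?case
    proof (intro conjI ballI)
      fix \<xi> assume \<xi>: "\<xi> \<in> ?V"
      have "nrm (orbit r (F h) (G h) \<xi> 0 - orbit r (F 0) (G 0) \<xi> 0) \<le> \<epsilon>" using elim(2) \<xi> by blast
      then show "nrm (graph_map r (F h) (G h) \<xi> - graph_map r (F 0) (G 0) \<xi>) \<le> \<epsilon>" using o[OF \<xi>] by simp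
      fix \<xi>' assume \<xi>': "\<xi>' \<in> ?V"
      have "nrm (orbit r (F h) (G h) \<xi> 0 - orbit r (F h) (G h) \<xi>' 0
        - (orbit r (F 0) (G 0) \<xi> 0 - orbit r (F 0) (G 0) \<xi>' 0)) \<le> \<epsilon> * nrm (\<xi> - \<xi>')" using elim(2) \<xi> \<xi>' by blast
      then show "nrm (graph_map r (F h) (G h) \<xi> - graph_map r (F 0) (G 0) \<xi> -
        (graph_map r (F h) (G h) \<xi>' - graph_map r (F 0) (G 0) \<xi>')) \<le> \<epsilon> * nrm (\<xi> - \<xi>')" 
        using o[OF \<xi>] o[OF \<xi>'] by (simp add: algebra_simps)
    qed
  qed
qed

end

end

section \<open>Hyperbolic operators\<close>

locale hyperbolic =
  fixes L :: "'a::banach \<Rightarrow>\<^sub>L 'a" and a b :: real and nrm :: "'a \<Rightarrow> real"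
  assumes hyperbolic: "hyperbolic_operator L a b nrm"
begin

sublocale adapted_norm nrm
  using hyperbolic by unfold_locales (simp add: hyperbolic_operator_def)

abbreviation "P \<equiv> proj_s L"
abbreviation "Q \<equiv> proj_u L"
abbreviation "Ss \<equiv> space_s L"
abbreviation "Su \<equiv> space_u L"
abbreviation "Linv \<equiv> inv_into Su (blinfun_apply L)"

lemma ab: "0 < b" "b < 1" "1 < a"
  using hyperbolic by (auto simp: hyperbolic_operator_def)

lemma linear_P: "linear P" and linear_Q: "linear Q"
proof -
  show P: "linear P"
    by (rule linearI) (simp_all add: proj_s_def blinfun.add_right[symmetric] blinfun.scaleR_right[symmetric]
      flip: fst_add fst_scaleR scaleR_right_distrib blinfun.add_right)
  show "linear Q" unfolding proj_u_def using P by (intro linear_compose_sub linear_ident) 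
qed

lemma P_add_Q: "P x + Q x = x" by (simp add: proj_u_def)
lemma P_in: "P x \<in> Ss" and Q_in: "Q x \<in> Su" by (simp_all add: space_s_def space_u_def)

lemma subspace_Ss: "subspace Ss" and subspace_Su: "subspace Su"
  unfolding space_s_def space_u_def 
  using linear_P linear_Q subspace_UNIV by (auto intro: linear_subspace_image)

lemma nrm_max: "v \<in> Su \<Longrightarrow> w \<in> Ss \<Longrightarrow> nrm (v + w) = max (nrm v) (nrm w)"
  using hyperbolic by (simp add: hyperbolic_operator_def)

text \<open>A vector in both subspaces satisfies \<open>0 = nrm (v - v) = max (nrm v) (nrm v)\<close>. With \<open>P x + Q x = x\<close> this
  already makes \<open>P\<close> and \<open>Q\<close> the projections of a direct sum, whatever the contour integral is.\<close>

lemma Ss_Int_Su: "v \<in> Ss \<Longrightarrow> v \<in> Su \<Longrightarrow> v = 0"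
  using nrm_max[of v "- v"] subspace_neg[OF subspace_Ss] by simp

lemma split_iff:
  assumes "u \<in> Ss" "v \<in> Su"
  shows "x = u + v \<longleftrightarrow> P x = u \<and> Q x = v"
proof
  assume x: "x = u + v"
  have "P x - u = v - Q x" using P_add_Q[of x] x by (simp add: algebra_simps)
  moreover have "P x - u \<in> Ss" "v - Q x \<in> Su"
    using assms P_in Q_in subspace_diff[OF subspace_Ss] subspace_diff[OF subspace_Su] by auto
  ultimately have "P x - u = 0" using Ss_Int_Su by metis
  then show "P x = u \<and> Q x = v" using \<open>P x - u = v - Q x\<close> by simp
next
  assume "P x = u \<and> Q x = v" then show "x = u + v" using P_add_Q[of x] by simp
qed

lemma nrm_split: "nrm x = max (nrm (P x)) (nrm (Q x))"
  using nrm_max[OF Q_in P_in, of x x] P_add_Q[of x] by (simp add: add.commute max.commute)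

lemma nrm_P_le: "nrm (P x) \<le> nrm x" and nrm_Q_le: "nrm (Q x) \<le> nrm x"
  using nrm_split[of x] by auto

text \<open>The spectral condition at a single point outside the disc, \<open>1\<close>, says that \<open>1 - L\<close> maps the stable
  subspace to itself.\<close>

lemma L_Ss: assumes "w \<in> Ss" shows "blinfun_apply L w \<in> Ss"
proof -
  have "1 \<notin> spectrum_on Ss L" using hyperbolic by (auto simp: hyperbolic_operator_def)
  then have "bij_betw (shifted 1 L) (Ss \<times> Ss) (Ss \<times> Ss)" by (simp add: spectrum_on_def)
  moreover have "(w, 0) \<in> Ss \<times> Ss" using assms subspace_0[OF subspace_Ss] by simp
  ultimately have "shifted 1 L (w, 0) \<in> Ss \<times> Ss" by (metis bij_betwE)
  then have "w - blinfun_apply L w \<in> Ss" by (simp add: shifted_def cscale_def)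
  from subspace_diff[OF subspace_Ss assms this] show ?thesis by simp
qed

text \<open>The point \<open>0\<close> lies outside the spectrum on the unstable subspace, so \<open>- L\<close> on pairs is a
  bijection with bounded inverse; the first components give the claim for \<open>L\<close>.\<close>

lemma bij_L_Su: "bij_betw (blinfun_apply L) Su Su"
  and Linv_bounded: "\<exists>K. \<forall>v\<in>Su. norm (Linv v) \<le> K * norm v"
proof -
  have "0 \<notin> spectrum_on Su L" using hyperbolic ab by (auto simp: hyperbolic_operator_def)
  then obtain K where bij: "bij_betw (shifted 0 L) (Su \<times> Su) (Su \<times> Su)"
    and K: "\<forall>z\<in>Su \<times> Su. norm (inv_into (Su \<times> Su) (shifted 0 L) z) \<le> K * norm z" 
    by (auto simp: spectrum_on_def)
  have sh: "shifted 0 L (x, y) = (- blinfun_apply L x, - blinfun_apply L y)" for x y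
    by (simp add: shifted_def cscale_def)
  have 0: "0 \<in> Su" using subspace_0[OF subspace_Su] .
  have LSu: "blinfun_apply L v \<in> Su" if "v \<in> Su" for v
  proof -
    have "shifted 0 L (v, 0) \<in> Su \<times> Su" using bij_betwE[OF bij] that 0 by auto
    then show ?thesis using subspace_neg[OF subspace_Su] by (fastforce simp: sh)
  qed
  have inj: "inj_on (blinfun_apply L) Su"
  proof (rule inj_onI)
    fix v v' assume v: "v \<in> Su" "v' \<in> Su" and eq: "blinfun_apply L v = blinfun_apply L v'"
    have "(v, 0) = (v', 0::'a)"
    proof (rule inj_onD[OF bij_betw_imp_inj_on[OF bij]])
      show "shifted 0 L (v, 0) = shifted 0 L (v', 0)" by (simp add: sh eq)
    qed (use v 0 in auto)
    then show "v = v'" by simp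
  qed
  have pre: "\<exists>u\<in>Su. blinfun_apply L u = v \<and> norm u \<le> K * norm v" if v: "v \<in> Su" for v
  proof -
    let ?z = "inv_into (Su \<times> Su) (shifted 0 L) (- v, 0)"
    have v': "(- v, 0) \<in> Su \<times> Su" using v 0 subspace_neg[OF subspace_Su] by simp
    then have z: "?z \<in> Su \<times> Su" "shifted 0 L ?z = (- v, 0)"
      using bij by (metis bij_betw_def inv_into_into, metis bij_betw_inv_into_right)
    have "norm (fst ?z) \<le> norm ?z" using norm_fst_le[of "fst ?z" "snd ?z"] by simp
    also have "\<dots> \<le> K * norm (- v, 0::'a)" using K v' by blast
    finally have "norm (fst ?z) \<le> K * norm v" by (simp add: norm_Pair)
    moreover have "fst ?z \<in> Su" "blinfun_apply L (fst ?z) = v"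
      using z sh[of "fst ?z" "snd ?z"] by (auto simp: mem_Times_iff)
    ultimately show ?thesis by blast
  qed
  show "bij_betw (blinfun_apply L) Su Su"
    unfolding bij_betw_def using inj LSu pre by blast
  have "norm (Linv v) \<le> K * norm v" if "v \<in> Su" for v
    using pre[OF that] by (auto simp: inv_into_f_f[OF inj])
  then show "\<exists>K. \<forall>v\<in>Su. norm (Linv v) \<le> K * norm v" by blast
qed

lemma L_Su: "v \<in> Su \<Longrightarrow> blinfun_apply L v \<in> Su"
  using bij_betwE[OF bij_L_Su] by blast

lemma Linv_in: "v \<in> Su \<Longrightarrow> Linv v \<in> Su"
  using bij_L_Su by (metis bij_betw_def inv_into_into)

lemma L_Linv: "v \<in> Su \<Longrightarrow> blinfun_apply L (Linv v) = v"
  by (rule bij_betw_inv_into_right[OF bij_L_Su])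

lemma Linv_L: "v \<in> Su \<Longrightarrow> Linv (blinfun_apply L v) = v"
  by (rule bij_betw_inv_into_left[OF bij_L_Su])

lemma Linv_diff:
  assumes "v \<in> Su" "w \<in> Su"
  shows "Linv (v - w) = Linv v - Linv w"
proof -
  have "Linv (blinfun_apply L (Linv v - Linv w)) = Linv v - Linv w"
    using assms by (intro Linv_L subspace_diff[OF subspace_Su] Linv_in)
  then show ?thesis using assms by (simp add: blinfun.diff_right L_Linv)
qed

text \<open>A real supremum bounds its members only if they are bounded above; the constant \<open>K\<close> provides this.\<close>

lemma op_norm_on_bound:
  assumes le: "op_norm_on nrm V f \<le> c" and K: "\<forall>x\<in>V. norm (f x) \<le> K * norm x" and x: "x \<in> V" "f 0 = 0"
  shows "nrm (f x) \<le> c * nrm x"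
proof (cases "x = 0")
  case False
  obtain c1 C1 where c: "0 < c1" "0 < C1" "\<And>x. c1 * norm x \<le> nrm x" "\<And>x. nrm x \<le> C1 * norm x"
    using comparison by blast
  have "nrm (f y) / nrm y \<le> C1 * \<bar>K\<bar> / c1" if "y \<in> V" for y
  proof (cases "y = 0")
    case True
    then show ?thesis using x c by simp
  next
    case False
    have "norm (f y) \<le> \<bar>K\<bar> * norm y"
      using K that mult_right_mono[OF abs_ge_self[of K], of "norm y"] by (meson norm_ge_zero order_trans)
    then have "nrm (f y) \<le> C1 * (\<bar>K\<bar> * norm y)"
      using c(4)[of "f y"] mult_left_mono[of "norm (f y)" "\<bar>K\<bar> * norm y" C1] c(2) by linarith
    moreover have "c1 * (C1 * (\<bar>K\<bar> * norm y)) \<le> (C1 * \<bar>K\<bar>) * nrm y"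
      using mult_left_mono[OF c(3)[of y], of "C1 * \<bar>K\<bar>"] c by (simp add: mult_ac)
    ultimately have "c1 * nrm (f y) \<le> (C1 * \<bar>K\<bar>) * nrm y" 
      using c(1) using mult_left_mono[of "nrm (f y)" "C1 * (\<bar>K\<bar> * norm y)" c1] by linarith
    moreover have "nrm y > 0" using False nrm_nonneg[of y] by (simp add: less_le del: nrm_nonneg)
    ultimately show ?thesis using c(1) by (simp add: field_simps)
  qed
  then have "bdd_above ((\<lambda>y. nrm (f y) / nrm y) ` V)" by (auto intro!: bdd_aboveI)
  then have "nrm (f x) / nrm x \<le> op_norm_on nrm V f" unfolding op_norm_on_def by (rule cSUP_upper2[OF _ x(1)]) simp
  with le have "nrm (f x) / nrm x \<le> c" by simp
  moreover have "nrm x > 0" using False nrm_nonneg[of x] by (simp add: less_le del: nrm_nonneg)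
  ultimately show ?thesis by (simp add: field_simps)
qed (use x in simp)

lemma nrm_L_Ss: "w \<in> Ss \<Longrightarrow> nrm (blinfun_apply L w) \<le> b * nrm w"
  by (rule op_norm_on_bound[where V = Ss and K = "norm L"])
     (use hyperbolic norm_blinfun in \<open>auto simp: hyperbolic_operator_def\<close>)

lemma nrm_Linv: assumes "v \<in> Su" shows "nrm (Linv v) \<le> nrm v / a"
proof -
  obtain K where K: "\<forall>v\<in>Su. norm (Linv v) \<le> K * norm v" using Linv_bounded by blast
  have "nrm (Linv v) \<le> inverse a * nrm v"
  proof (rule op_norm_on_bound[OF _ K assms])
    show "op_norm_on nrm Su Linv \<le> inverse a" using hyperbolic by (simp add: hyperbolic_operator_def)
    show "Linv 0 = 0" using Linv_L[OF subspace_0[OF subspace_Su]] by simp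
  qed
  then show ?thesis by (simp add: field_simps)
qed

lemma P_L: "P (blinfun_apply L x) = blinfun_apply L (P x)"
  and Q_L: "Q (blinfun_apply L x) = blinfun_apply L (Q x)"
proof -
  have "blinfun_apply L x = blinfun_apply L (P x) + blinfun_apply L (Q x)"
    by (simp add: P_add_Q flip: blinfun.add_right)
  then show "P (blinfun_apply L x) = blinfun_apply L (P x)" "Q (blinfun_apply L x) = blinfun_apply L (Q x)"
    using split_iff[OF L_Ss[OF P_in] L_Su[OF Q_in]] by blast+
qed

definition fwd :: "('a \<Rightarrow> 'a) \<Rightarrow> 'a \<Rightarrow> 'a" where
  "fwd N z = P (blinfun_apply L z + N z)"

definition bwd :: "('a \<Rightarrow> 'a) \<Rightarrow> 'a \<Rightarrow> 'a \<Rightarrow> 'a" where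
  "bwd N z z' = Linv (Q (z' - N z))"

text \<open>One step of the map, with the stable component read forwards and the unstable one solved for the
  earlier point by means of the inverse of \<open>L\<close>.\<close>

lemma step_iff: "z' = blinfun_apply L z + N z \<longleftrightarrow> P z' = fwd N z \<and> Q z = bwd N z z'"
proof -
  have "z' = blinfun_apply L z + N z \<longleftrightarrow> P z' = fwd N z \<and> Q z' = Q (blinfun_apply L z + N z)"
    unfolding fwd_def using split_iff[OF P_in Q_in, of z'] P_add_Q by metis
  also have "Q z' = Q (blinfun_apply L z + N z) \<longleftrightarrow> Q (z' - N z) = blinfun_apply L (Q z)"
    by (simp add: linear_add[OF linear_Q] linear_diff[OF linear_Q] Q_L algebra_simps)
  also have "\<dots> \<longleftrightarrow> Q z = bwd N z z'"
    unfolding bwd_def using Linv_L[OF Q_in[of z]] L_Linv[OF Q_in[of "z' - N z"]] by metis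
  finally show ?thesis .
qed

lemma fwd_in: "fwd N z \<in> Ss" and bwd_in: "bwd N z z' \<in> Su"
  by (simp_all add: fwd_def bwd_def P_in Q_in Linv_in)

lemma nrm_P_L_add: "nrm (P (blinfun_apply L x + y)) \<le> b * nrm x + nrm y"
proof -
  have "nrm (P (blinfun_apply L x + y)) \<le> nrm (blinfun_apply L (P x)) + nrm (P y)"
    by (simp add: linear_add[OF linear_P] P_L triangle)
  also have "\<dots> \<le> b * nrm (P x) + nrm y" by (intro add_mono nrm_L_Ss P_in nrm_P_le)
  also have "\<dots> \<le> b * nrm x + nrm y" using nrm_P_le[of x] ab by simp
  finally show ?thesis .
qed

lemma nrm_Linv_Q_diff: "nrm (Linv (Q (x - y))) \<le> (nrm x + nrm y) / a"
  using nrm_Linv[OF Q_in, of "x - y"] nrm_Q_le[of "x - y"] triangle_diff[of x y] ab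
  by (smt (verit) divide_right_mono)

lemma fwd_diff: "fwd N p - fwd M q = P (blinfun_apply L (p - q) + (N p - M q))"
  by (simp add: fwd_def linear_add[OF linear_P] linear_diff[OF linear_P] blinfun.diff_right)

lemma bwd_diff: "bwd N p p' - bwd M q q' = Linv (Q ((p' - q') - (N p - M q)))"
  unfolding bwd_def by (simp add: Linv_diff[symmetric] Q_in linear_diff[OF linear_Q, symmetric] algebra_simps)

lemma fwd_diff2: "fwd N p - fwd N p' - (fwd M q - fwd M q') =
    P (blinfun_apply L (p - p' - (q - q')) + (N p - N p' - (M q - M q')))"
  by (simp add: fwd_diff linear_diff[OF linear_P, symmetric] blinfun.diff_right blinfun.add_right algebra_simps)

lemma bwd_diff2: "bwd N p r - bwd N p' r' - (bwd M q s - bwd M q' s') =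
    Linv (Q ((r - r' - (s - s')) - (N p - N p' - (M q - M q'))))"
  unfolding bwd_diff by (simp add: Linv_diff[symmetric] Q_in linear_diff[OF linear_Q, symmetric] algebra_simps)

sublocale stable: split_norm nrm Ss Su
proof unfold_locales
  show "nrm (v + w) = max (nrm v) (nrm w)" if "v \<in> Ss" "w \<in> Su" for v w
    using nrm_max[OF that(2,1)] by (simp add: add.commute max.commute)
qed (rule subspace_Ss subspace_Su)+

sublocale unstable: split_norm nrm Su Ss
  by unfold_locales (fact subspace_Su subspace_Ss nrm_max)+

text \<open>Forward orbits: the index is the time, so \<open>G\<close> is the forward equation and sees the earlier point,
  while \<open>F\<close> recovers the unstable component from the later point.\<close>

lemma sol_stable_iff:
  assumes "\<xi> \<in> Ss"
  shows "stable.sol (\<lambda>w. bwd N (fst w) (snd w)) (\<lambda>w. fwd N (fst w)) \<xi> z \<longleftrightarrow>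
    P (z 0) = \<xi> \<and> (\<forall>n. z (Suc n) = blinfun_apply L (z n) + N (z n))"
proof -
  have "stable.sol (\<lambda>w. bwd N (fst w) (snd w)) (\<lambda>w. fwd N (fst w)) \<xi> z \<longleftrightarrow>
     P (z 0) = \<xi> \<and> Q (z 0) = bwd N (z 0) (z 1) \<and>
     (\<forall>n. P (z (Suc n)) = fwd N (z n) \<and> Q (z (Suc n)) = bwd N (z (Suc n)) (z (Suc (Suc n))))"
    unfolding stable.sol_def fst_conv snd_conv
      split_iff[OF assms bwd_in] split_iff[OF fwd_in bwd_in] by simp
  also have "\<dots> \<longleftrightarrow> P (z 0) = \<xi> \<and> (\<forall>n. P (z (Suc n)) = fwd N (z n) \<and> Q (z n) = bwd N (z n) (z (Suc n)))"
    by (auto simp del: One_nat_def) (metis One_nat_def nat.exhaust)+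
  finally show ?thesis by (simp add: step_iff)
qed

text \<open>Backward orbits: \<open>z n\<close> is the point at time \<open>-n\<close>, so the second argument is the earlier point and the
  forward equation now determines the free, stable component.\<close>

lemma sol_unstable_iff:
  assumes "\<xi> \<in> Su"
  shows "unstable.sol (\<lambda>w. fwd N (snd w)) (\<lambda>w. bwd N (snd w) (fst w)) \<xi> z \<longleftrightarrow>
    Q (z 0) = \<xi> \<and> (\<forall>n. z n = blinfun_apply L (z (Suc n)) + N (z (Suc n)))"
proof -
  have "x = u + v \<longleftrightarrow> P x = v \<and> Q x = u" if "u \<in> Su" "v \<in> Ss" for x u v
    using split_iff[OF that(2,1), of x] by (simp add: add.commute)
  note s = this
  have "unstable.sol (\<lambda>w. fwd N (snd w)) (\<lambda>w. bwd N (snd w) (fst w)) \<xi> z \<longleftrightarrow>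
     Q (z 0) = \<xi> \<and> P (z 0) = fwd N (z 1) \<and>
     (\<forall>n. P (z (Suc n)) = fwd N (z (Suc (Suc n))) \<and> Q (z (Suc n)) = bwd N (z (Suc n)) (z n))"
    unfolding unstable.sol_def fst_conv snd_conv
      s[OF assms fwd_in] s[OF bwd_in fwd_in] by auto
  also have "\<dots> \<longleftrightarrow> Q (z 0) = \<xi> \<and> (\<forall>n. P (z n) = fwd N (z (Suc n)) \<and> Q (z (Suc n)) = bwd N (z (Suc n)) (z n))"
    by (auto simp del: One_nat_def) (metis One_nat_def nat.exhaust)+
  finally show ?thesis by (simp add: step_iff)
qed

end

section \<open>Local manifolds of a family with a common splitting\<close>

text \<open>Maps \<open>z \<mapsto> L z + N h z\<close> with a common linear part. The gap conditions are what is needed for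
  \<open>max (b + g) ((1 + g) / a) < 1\<close>.\<close>

locale hyperbolic_family = hyperbolic L a b nrm
  for L :: "'a::banach \<Rightarrow>\<^sub>L 'a" and a b :: real and nrm :: "'a \<Rightarrow> real" +
  fixes N :: "real \<Rightarrow> 'a \<Rightarrow> 'a" and g R h0 :: real
  assumes gap: "0 \<le> g" "b + g < 1" "1 + g < a"
    and R: "0 < R" and h0: "0 < h0"
    and N0: "\<And>h. h \<in> {0..h0} \<Longrightarrow> N h 0 = 0"
    and N_lip: "\<And>h p q. h \<in> {0..h0} \<Longrightarrow> nrm p < R \<Longrightarrow> nrm q < R \<Longrightarrow>
       nrm (N h p - N h q) \<le> g * nrm (p - q)"
    and N_regular: "regular_family nrm {z. nrm z < R} g N"
begin

definition "\<kappa> = max (b + g) ((1 + g) / a)"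
definition "rate = (1 - \<kappa>) / 2"

lemma \<kappa>: "0 \<le> \<kappa>" "\<kappa> < 1"
  using gap ab by (auto simp: \<kappa>_def le_max_iff_disj)

text \<open>The midpoint of \<open>\<kappa>\<close> and \<open>1\<close> as \<open>1 - rate\<close> serves both manifolds, as \<open>(1 + rate) * \<kappa> \<le> 1\<close>
  amounts to \<open>0 \<le> (1 - \<kappa>) * (2 - \<kappa>)\<close>.\<close>

lemma rate: "0 < rate" "rate < 1" "\<kappa> < 1 - rate" "(1 + rate) * \<kappa> \<le> 1"
proof -
  have "0 \<le> (1 - \<kappa>) * (2 - \<kappa>)" using \<kappa> by simp
  then have "(3 - \<kappa>) * \<kappa> \<le> 2" by (simp add: algebra_simps)
  then show "(1 + rate) * \<kappa> \<le> 1" by (simp add: rate_def algebra_simps add_divide_distrib diff_divide_distrib)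
qed (use \<kappa> in \<open>auto simp: rate_def field_simps\<close>)

definition f where "f h z = blinfun_apply L z + N h z"

lemma nrm_P_L_add_le:
  assumes "nrm y \<le> g * m + c" "nrm x \<le> m"
  shows "nrm (P (blinfun_apply L x + y)) \<le> \<kappa> * m + c"
proof -
  have "nrm (P (blinfun_apply L x + y)) \<le> b * m + (g * m + c)"
    using nrm_P_L_add[of x y] mult_left_mono[OF assms(2), of b] assms(1) ab by linarith
  also have "\<dots> = (b + g) * m + c" by (simp add: distrib_right)
  also have "\<dots> \<le> \<kappa> * m + c"
    using assms(2) nrm_nonneg[of x] unfolding \<kappa>_def by (intro add_mono mult_right_mono) (auto simp del: nrm_nonneg)
  finally show ?thesis .
qed

lemma nrm_Linv_Q_diff_le:
  assumes "nrm y \<le> g * m + c" "nrm x \<le> m" "0 \<le> c"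
  shows "nrm (Linv (Q (x - y))) \<le> \<kappa> * m + c"
proof -
  have "nrm (Linv (Q (x - y))) \<le> (m + (g * m + c)) / a"
    using nrm_Linv_Q_diff[of x y] divide_right_mono[of "nrm x + nrm y" "m + (g * m + c)" a] assms ab by linarith
  also have "\<dots> = (1 + g) / a * m + c / a" by (simp add: add_divide_distrib distrib_right)
  also have "\<dots> \<le> \<kappa> * m + c"
  proof (intro add_mono mult_right_mono)
    show "c / a \<le> c" using assms(3) ab by (simp add: divide_le_eq mult_le_cancel_left1)
    show "0 \<le> m" using assms(2) nrm_nonneg[of x] by (simp del: nrm_nonneg)
  qed (simp add: \<kappa>_def)
  finally show ?thesis .
qed

text \<open>The two manifolds use the components of a pair in opposite order; estimates for an
  arbitrary coordinate cover both.\<close>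

definition coordinate :: "('a \<times> 'a \<Rightarrow> 'a) \<Rightarrow> bool" where
  "coordinate u \<longleftrightarrow> u = fst \<or> u = snd"

lemma coordinate_fst_snd [simp]: "coordinate fst" "coordinate snd"
  by (simp_all add: coordinate_def)

lemma coordinate_diff: "coordinate u \<Longrightarrow> u (p - q) = u p - u q"
  and coordinate_le: "coordinate u \<Longrightarrow> nrm (u p) \<le> pair_nrm p"
  by (auto simp: coordinate_def pair_nrm_def)

context
  fixes r assumes r: "0 < r" "r \<le> R"
begin

lemma coordinate_less: "coordinate u \<Longrightarrow> pair_nrm p < r \<Longrightarrow> nrm (u p) < R"
  using coordinate_le[of u p] r by simp

lemma coordinate_diff_le: "coordinate u \<Longrightarrow> nrm (u p - u q) \<le> pair_nrm (p - q)"
  using coordinate_le[of u "p - q"] by (simp add: coordinate_diff)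

lemma coordinate_diff_le2: "coordinate u \<Longrightarrow> nrm (u p - u p' - (u q - u q')) \<le> pair_nrm (p - p' - (q - q'))"
  using coordinate_le[of u "p - p' - (q - q')"] by (simp add: coordinate_diff)

lemma fwd_contracts:
  assumes "h \<in> {0..h0}" "coordinate u" "pair_nrm p < r" "pair_nrm q < r"
  shows "nrm (fwd (N h) (u p) - fwd (N h) (u q)) \<le> \<kappa> * pair_nrm (p - q)"
proof -
  have "nrm (N h (u p) - N h (u q)) \<le> g * pair_nrm (p - q)"
    using N_lip[OF assms(1) coordinate_less coordinate_less] assms
      mult_left_mono[OF coordinate_diff_le gap(1), of u p q] by (meson order_trans)
  then show ?thesis
    using nrm_P_L_add_le[of "N h (u p) - N h (u q)" "pair_nrm (p - q)" 0] coordinate_diff_le[OF assms(2), of p q]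
    by (simp add: fwd_diff)
qed

lemma bwd_contracts:
  assumes "h \<in> {0..h0}" "coordinate u" "coordinate v" "pair_nrm p < r" "pair_nrm q < r"
  shows "nrm (bwd (N h) (u p) (v p) - bwd (N h) (u q) (v q)) \<le> \<kappa> * pair_nrm (p - q)"
proof -
  have "nrm (N h (u p) - N h (u q)) \<le> g * pair_nrm (p - q)"
    using N_lip[OF assms(1) coordinate_less coordinate_less] assms
      mult_left_mono[OF coordinate_diff_le gap(1), of u p q] by (meson order_trans)
  then show ?thesis
    using nrm_Linv_Q_diff_le[of "N h (u p) - N h (u q)" "pair_nrm (p - q)" 0] coordinate_diff_le[OF assms(3), of p q]
    by (simp add: bwd_diff)
qed

text \<open>The maps \<open>fwd\<close> and \<open>bwd\<close> are linear in the points and in the value of \<open>N\<close> together, so an estimate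
  for differences of \<open>N\<close> becomes one for them with \<open>g\<close> replaced by \<open>\<kappa>\<close>.\<close>

lemma regular_family_pullback:
  assumes u: "coordinate u"
    and close: "\<And>h p c. 0 \<le> c \<Longrightarrow> nrm (N h (u p) - N 0 (u p)) \<le> c \<Longrightarrow> nrm (\<Phi> h p - \<Phi> 0 p) \<le> c"
    and double: "\<And>h p p' q q' c. 0 \<le> c \<Longrightarrow>
      nrm (N h (u p) - N h (u p') - (N 0 (u q) - N 0 (u q'))) \<le> g * pair_nrm (p - p' - (q - q')) + c \<Longrightarrow>
      nrm (\<Phi> h p - \<Phi> h p' - (\<Phi> 0 q - \<Phi> 0 q')) \<le> \<kappa> * pair_nrm (p - p' - (q - q')) + c"
  shows "regular_family pair_nrm {w. pair_nrm w < r} \<kappa> \<Phi>"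
  unfolding regular_family_def
proof (intro conjI allI impI)
  let ?S = "{w. pair_nrm w < r}" and ?B = "{z. nrm z < R}"
  have uS: "u p \<in> ?B" if "p \<in> ?S" for p using coordinate_less[OF u] that by simp
  fix \<epsilon> :: real assume \<epsilon>: "0 < \<epsilon>"
  show "\<forall>\<^sub>F h in at_right 0. \<forall>p\<in>?S. nrm (\<Phi> h p - \<Phi> 0 p) \<le> \<epsilon>"
    using regular_family_tendsto[OF N_regular \<epsilon>]
    by (rule eventually_mono) (use close uS \<epsilon> in \<open>blast intro: less_imp_le\<close>)
  obtain \<delta> where \<delta>: "\<delta> > 0" "\<forall>\<^sub>F h in at_right 0. \<forall>p\<in>?B. \<forall>p'\<in>?B. \<forall>q\<in>?B. \<forall>q'\<in>?B.
      nrm (p - q) \<le> \<delta> \<longrightarrow> nrm (p' - q') \<le> \<delta> \<longrightarrow>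
      nrm (N h p - N h p' - (N 0 q - N 0 q')) \<le> g * nrm (p - p' - (q - q')) + \<epsilon> * nrm (p - p')"
    using regular_family_double_difference[OF N_regular \<epsilon>] by blast
  show "\<exists>\<delta>>0. \<forall>\<^sub>F h in at_right 0. \<forall>p\<in>?S. \<forall>p'\<in>?S. \<forall>q\<in>?S. \<forall>q'\<in>?S.
      pair_nrm (p - q) \<le> \<delta> \<longrightarrow> pair_nrm (p' - q') \<le> \<delta> \<longrightarrow>
      nrm (\<Phi> h p - \<Phi> h p' - (\<Phi> 0 q - \<Phi> 0 q'))
        \<le> \<kappa> * pair_nrm (p - p' - (q - q')) + \<epsilon> * pair_nrm (p - p')"
  proof (intro exI[of _ \<delta>] conjI \<delta>(1) eventually_mono[OF \<delta>(2)] ballI impI)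
    fix h p p' q q'
    assume elim: "\<forall>p\<in>?B. \<forall>p'\<in>?B. \<forall>q\<in>?B. \<forall>q'\<in>?B.
      nrm (p - q) \<le> \<delta> \<longrightarrow> nrm (p' - q') \<le> \<delta> \<longrightarrow>
      nrm (N h p - N h p' - (N 0 q - N 0 q')) \<le> g * nrm (p - p' - (q - q')) + \<epsilon> * nrm (p - p')"
      and S: "p \<in> ?S" "p' \<in> ?S" "q \<in> ?S" "q' \<in> ?S"
      and cl: "pair_nrm (p - q) \<le> \<delta>" "pair_nrm (p' - q') \<le> \<delta>"
    have "nrm (N h (u p) - N h (u p') - (N 0 (u q) - N 0 (u q')))
        \<le> g * nrm (u p - u p' - (u q - u q')) + \<epsilon> * nrm (u p - u p')"
      using elim uS[OF S(1)] uS[OF S(2)] uS[OF S(3)] uS[OF S(4)]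
        order_trans[OF coordinate_diff_le[OF u] cl(1)] order_trans[OF coordinate_diff_le[OF u] cl(2)]
      by blast
    also have "\<dots> \<le> g * pair_nrm (p - p' - (q - q')) + \<epsilon> * pair_nrm (p - p')"
      using coordinate_diff_le2[OF u] coordinate_diff_le[OF u] gap(1) \<epsilon>
      by (intro add_mono mult_left_mono) auto
    finally show "nrm (\<Phi> h p - \<Phi> h p' - (\<Phi> 0 q - \<Phi> 0 q'))
        \<le> \<kappa> * pair_nrm (p - p' - (q - q')) + \<epsilon> * pair_nrm (p - p')"
      using \<epsilon> by (intro double) auto
  qed
qed

lemma fwd_regular:
  assumes u: "coordinate u"
  shows "regular_family pair_nrm {w. pair_nrm w < r} \<kappa> (\<lambda>h w. fwd (N h) (u w))"
proof (rule regular_family_pullback[OF u])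
  fix h p and c :: real assume "0 \<le> c" "nrm (N h (u p) - N 0 (u p)) \<le> c"
  then show "nrm (fwd (N h) (u p) - fwd (N 0) (u p)) \<le> c"
    using nrm_P_L_add_le[of "N h (u p) - N 0 (u p)" 0 c 0] by (simp add: fwd_diff)
qed (simp add: fwd_diff2 nrm_P_L_add_le coordinate_diff_le2[OF u])

lemma bwd_regular:
  assumes u: "coordinate u" and v: "coordinate v"
  shows "regular_family pair_nrm {w. pair_nrm w < r} \<kappa> (\<lambda>h w. bwd (N h) (u w) (v w))"
proof (rule regular_family_pullback[OF u])
  fix h p and c :: real assume "0 \<le> c" "nrm (N h (u p) - N 0 (u p)) \<le> c"
  then show "nrm (bwd (N h) (u p) (v p) - bwd (N 0) (u p) (v p)) \<le> c"
    using nrm_Linv_Q_diff_le[of "N h (u p) - N 0 (u p)" 0 c 0] by (simp add: bwd_diff)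
qed (simp add: bwd_diff2 nrm_Linv_Q_diff_le coordinate_diff_le2[OF v])

abbreviation "Fs h \<equiv> \<lambda>w. bwd (N h) (fst w) (snd w)"
abbreviation "Gs h \<equiv> \<lambda>w. fwd (N h) (fst w)"
abbreviation "Fu h \<equiv> \<lambda>w. fwd (N h) (snd w)"
abbreviation "Gu h \<equiv> \<lambda>w. bwd (N h) (snd w) (fst w)"

lemma stable_contracting: "h \<in> {0..h0} \<Longrightarrow> stable.contracting \<kappa> r (Fs h) (Gs h)"
  and unstable_contracting: "h \<in> {0..h0} \<Longrightarrow> unstable.contracting \<kappa> r (Fu h) (Gu h)"
proof -
  assume h: "h \<in> {0..h0}"
  have 0: "fwd (N h) 0 = 0" "bwd (N h) 0 0 = 0"
    using fwd_diff[of "N h" 0 "\<lambda>_. 0" 0] Linv_L[OF subspace_0[OF subspace_Su]]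
    by (simp_all add: fwd_def bwd_def N0[OF h] linear_0[OF linear_P] linear_0[OF linear_Q])
  show "stable.contracting \<kappa> r (Fs h) (Gs h)" "unstable.contracting \<kappa> r (Fu h) (Gu h)"
    unfolding stable.contracting_def unstable.contracting_def
    using fwd_contracts[OF h] bwd_contracts[OF h] by (auto simp: 0 fwd_in bwd_in)
qed

definition stable_map :: "real \<Rightarrow> 'a \<Rightarrow> 'a" where
  "stable_map h = stable.graph_map r (Fs h) (Gs h)"

definition unstable_map :: "real \<Rightarrow> 'a \<Rightarrow> 'a" where
  "unstable_map h = unstable.graph_map r (Fu h) (Gu h)"

text \<open>Orbits in the ball are solutions of the boundary value problem, hence determined by their stable
  component at time \<open>0\<close>; conversely \<open>\<kappa> < 1 - rate\<close> gives solutions the required decay. The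
  graph lies over the full ball of radius \<open>r\<close> because the solution stays in the ball in which its
  prescribed component lies.\<close>

lemma local_stable_graph:
  assumes h: "h \<in> {0..h0}"
  shows "local_stable (f h) 0 rate {z. nrm z < r} = (\<lambda>m. stable_map h m + m) ` {m \<in> Ss. nrm m < r}"
proof (intro equalityI subsetI)
  note C = stable_contracting[OF h]
  fix x assume "x \<in> (\<lambda>m. stable_map h m + m) ` {m \<in> Ss. nrm m < r}"
  then obtain m where m: "m \<in> Ss" "nrm m < r" and x: "x = stable_map h m + m" by auto
  define z where "z = stable.orbit r (Fs h) (Gs h) m"
  have z: "stable.sol (Fs h) (Gs h) m z" and b: "nrm (z n) < r" for n
    unfolding z_def by (rule stable.orbit[OF \<kappa> r(1) C m])+
  have "(f h ^^ n) (z 0) = z n" for n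
    using z by (induction n) (auto simp: sol_stable_iff[OF m(1)] f_def)
  moreover have "z 0 = x"
    unfolding z_def by (simp add: stable.orbit_0[OF \<kappa> r(1) C m] x stable_map_def add.commute)
  ultimately have it: "(f h ^^ n) x = z n" for n by simp
  have "(\<lambda>n. norm (z n)) \<in> o(\<lambda>n. (1 - rate) ^ n)"
    using stable.sol_decay[OF \<kappa> r(1) b z C m(1)] \<kappa>(1) rate(3) by (rule smallo_of_decay)
  then show "x \<in> local_stable (f h) 0 rate {z. nrm z < r}"
    using b b[of 0] \<open>z 0 = x\<close> by (simp add: local_stable_def it)
next
  note C = stable_contracting[OF h]
  fix x assume "x \<in> local_stable (f h) 0 rate {z. nrm z < r}"
  then have b: "nrm ((f h ^^ n) x) < r" for n by (simp add: local_stable_def)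
  define z where "z n = (f h ^^ n) x" for n
  have m: "P x \<in> Ss" "nrm (P x) < r"
    using P_in nrm_P_le[of x] b[of 0] by simp_all
  have z: "stable.sol (Fs h) (Gs h) (P x) z"
    unfolding sol_stable_iff[OF m(1)] by (simp add: z_def f_def)
  have "z = stable.orbit r (Fs h) (Gs h) (P x)"
    by (rule stable.orbit_unique[OF \<kappa> r(1) C m z]) (simp add: z_def b)
  then have "z 0 = P x + stable_map h (P x)"
    by (simp add: stable.orbit_0[OF \<kappa> r(1) C m] stable_map_def)
  then have "x = stable_map h (P x) + P x" by (simp add: z_def add.commute)
  with m show "x \<in> (\<lambda>m. stable_map h m + m) ` {m \<in> Ss. nrm m < r}" by blast
qed

lemma local_unstable_graph:
  assumes h: "h \<in> {0..h0}"
  shows "local_unstable (f h) 0 rate {z. nrm z < r} = (\<lambda>k. k + unstable_map h k) ` {k \<in> Su. nrm k < r}"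
proof (intro equalityI subsetI)
  note C = unstable_contracting[OF h]
  fix x assume "x \<in> (\<lambda>k. k + unstable_map h k) ` {k \<in> Su. nrm k < r}"
  then obtain k where k: "k \<in> Su" "nrm k < r" and x: "x = k + unstable_map h k" by auto
  define z where "z = unstable.orbit r (Fu h) (Gu h) k"
  have z: "unstable.sol (Fu h) (Gu h) k z" and b: "nrm (z n) < r" for n
    unfolding z_def by (rule unstable.orbit[OF \<kappa> r(1) C k])+
  have z0: "z 0 = x"
    unfolding z_def by (simp add: unstable.orbit_0[OF \<kappa> r(1) C k] x unstable_map_def)
  have step: "z j = f h (z (Suc j))" for j
    using z unfolding sol_unstable_iff[OF k(1)] f_def by blast
  obtain c where c: "0 < c" "\<And>x. c * norm x \<le> nrm x" using comparison by blast
  have "(1 + rate) ^ j * norm (z j - 0) \<le> r / c" for j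
  proof -
    have "c * norm (z j) \<le> \<kappa> ^ j * nrm k"
      using c(2)[of "z j"] unstable.sol_decay[OF \<kappa> r(1) b z C k(1), of j] by linarith
    then have "(1 + rate) ^ j * (c * norm (z j)) \<le> (1 + rate) ^ j * (\<kappa> ^ j * nrm k)"
      using rate by (intro mult_left_mono) auto
    also have "\<dots> = ((1 + rate) * \<kappa>) ^ j * nrm k" by (simp add: power_mult_distrib)
    also have "\<dots> \<le> 1 * r"
      using rate \<kappa> k(2) by (intro mult_mono power_le_one) auto
    finally show ?thesis using c(1) by (simp add: field_simps)
  qed
  then have "bdd_above (range (\<lambda>j. (1 + rate) ^ j * norm (z j - 0)))" unfolding bdd_above_def by blast
  then show "x \<in> local_unstable (f h) 0 rate {z. nrm z < r}"
    unfolding local_unstable_def using b b[of 0] z0 step by blast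
next
  note C = unstable_contracting[OF h]
  fix x assume "x \<in> local_unstable (f h) 0 rate {z. nrm z < r}"
  then obtain z where z0: "z 0 = x" and b: "\<And>j. nrm (z j) < r" and step: "\<And>j. z j = f h (z (Suc j))"
    unfolding local_unstable_def by blast
  have k: "Q x \<in> Su" "nrm (Q x) < r"
    using Q_in nrm_Q_le[of x] b[of 0] z0 by simp_all
  have z: "unstable.sol (Fu h) (Gu h) (Q x) z"
    unfolding sol_unstable_iff[OF k(1)] using z0 step unfolding f_def by blast
  have "z = unstable.orbit r (Fu h) (Gu h) (Q x)"
    by (rule unstable.orbit_unique[OF \<kappa> r(1) C k z b])
  then have "z 0 = Q x + unstable_map h (Q x)"
    by (simp add: unstable.orbit_0[OF \<kappa> r(1) C k] unstable_map_def)
  with z0 have "x = Q x + unstable_map h (Q x)" by simp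
  with k show "x \<in> (\<lambda>k. k + unstable_map h k) ` {k \<in> Su. nrm k < r}" by blast
qed

lemma stable_map_in: "h \<in> {0..h0} \<Longrightarrow> stable_map h m \<in> Su"
  and unstable_map_in: "h \<in> {0..h0} \<Longrightarrow> unstable_map h m \<in> Ss"
  unfolding stable_map_def unstable_map_def stable.graph_map_def unstable.graph_map_def
  by (simp_all add: fwd_in bwd_in)

lemma stable_map_lipschitz:
  assumes "h \<in> {0..h0}" "m \<in> Ss" "nrm m < r" "m' \<in> Ss" "nrm m' < r"
  shows "nrm (stable_map h m - stable_map h m') \<le> nrm (m - m')"
  unfolding stable_map_def
  by (rule stable.graph_map_lipschitz[OF \<kappa> r(1) stable_contracting[OF assms(1)] assms(2-5)])

lemma unstable_map_lipschitz:
  assumes "h \<in> {0..h0}" "m \<in> Su" "nrm m < r" "m' \<in> Su" "nrm m' < r"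
  shows "nrm (unstable_map h m - unstable_map h m') \<le> nrm (m - m')"
  unfolding unstable_map_def
  by (rule unstable.graph_map_lipschitz[OF \<kappa> r(1) unstable_contracting[OF assms(1)] assms(2-5)])

lemma stable_map_tendsto: "lip_tendsto {m \<in> Ss. nrm m < r} stable_map"
  unfolding stable_map_def
  by (rule stable.graph_map_family[OF \<kappa> r(1) stable_contracting h0 bwd_regular fwd_regular]) simp_all

lemma unstable_map_tendsto: "lip_tendsto {k \<in> Su. nrm k < r} unstable_map"
  unfolding unstable_map_def
  by (rule unstable.graph_map_family[OF \<kappa> r(1) unstable_contracting h0 fwd_regular bwd_regular]) simp_all

text \<open>In the ball of radius \<open>R\<close> the maps \<open>f h\<close> have the Lipschitz constant \<open>1 + \<Lambda> + g\<close>, so the smallness of \<open>r\<close>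
  keeps the first \<open>n\<close> iterates of the graph in that ball, and the composition lemma can be used \<open>n\<close> times.\<close>

lemma iterated_unstable_tendsto:
  assumes \<Lambda>: "0 \<le> \<Lambda>" "\<And>x. nrm (blinfun_apply L x) \<le> \<Lambda> * nrm x"
    and small: "(1 + \<Lambda> + g) ^ n * r \<le> R"
  shows "lip_tendsto {k \<in> Su. nrm k < r} (\<lambda>h k. (f h ^^ n) (k + unstable_map h k))"
proof -
  define K where "K = 1 + \<Lambda> + g"
  have K: "1 \<le> K" using \<Lambda>(1) gap(1) by (simp add: K_def)
  let ?V = "{k \<in> Su. nrm k < r}" and ?B = "{z. nrm z < R}"
  define u where "u h k = k + unstable_map h k" for h k
  have f_regular: "regular_family nrm ?B K f"
    unfolding regular_family_def
  proof (intro conjI allI impI)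
    fix \<epsilon> :: real assume \<epsilon>: "0 < \<epsilon>"
    show "\<forall>\<^sub>F h in at_right 0. \<forall>p\<in>?B. nrm (f h p - f 0 p) \<le> \<epsilon>"
      using regular_family_tendsto[OF N_regular \<epsilon>] by (simp add: f_def)
    obtain \<delta> where \<delta>: "\<delta> > 0" "\<forall>\<^sub>F h in at_right 0. \<forall>p\<in>?B. \<forall>p'\<in>?B. \<forall>q\<in>?B. \<forall>q'\<in>?B.
        nrm (p - q) \<le> \<delta> \<longrightarrow> nrm (p' - q') \<le> \<delta> \<longrightarrow>
        nrm (N h p - N h p' - (N 0 q - N 0 q')) \<le> g * nrm (p - p' - (q - q')) + \<epsilon> * nrm (p - p')"
      using regular_family_double_difference[OF N_regular \<epsilon>] by blast
    have le: "nrm (f h p - f h p' - (f 0 q - f 0 q')) \<le> K * nrm (p - p' - (q - q')) + \<epsilon> * nrm (p - p')"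
      if "nrm (N h p - N h p' - (N 0 q - N 0 q')) \<le> g * nrm (p - p' - (q - q')) + \<epsilon> * nrm (p - p')" for h p p' q q'
    proof -
      have "f h p - f h p' - (f 0 q - f 0 q') = 
          blinfun_apply L (p - p' - (q - q')) + (N h p - N h p' - (N 0 q - N 0 q'))"
        by (simp add: f_def blinfun.diff_right blinfun.add_right algebra_simps)
      then have "nrm (f h p - f h p' - (f 0 q - f 0 q')) \<le> 
          \<Lambda> * nrm (p - p' - (q - q')) + (g * nrm (p - p' - (q - q')) + \<epsilon> * nrm (p - p'))"
        using triangle[of "blinfun_apply L (p - p' - (q - q'))" "N h p - N h p' - (N 0 q - N 0 q')"]
          \<Lambda>(2)[of "p - p' - (q - q')"] that by simp
      then show ?thesis unfolding K_def
        using nrm_nonneg[of "p - p' - (q - q')"] by (simp add: distrib_right del: nrm_nonneg)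
    qed
    have "\<forall>\<^sub>F h in at_right 0. \<forall>p\<in>?B. \<forall>p'\<in>?B. \<forall>q\<in>?B. \<forall>q'\<in>?B.
        nrm (p - q) \<le> \<delta> \<longrightarrow> nrm (p' - q') \<le> \<delta> \<longrightarrow>
        nrm (f h p - f h p' - (f 0 q - f 0 q')) \<le> K * nrm (p - p' - (q - q')) + \<epsilon> * nrm (p - p')"
      using \<delta>(2) by (rule eventually_mono) (blast intro: le)
    with \<delta>(1) show "\<exists>\<delta>>0. \<forall>\<^sub>F h in at_right 0. \<forall>p\<in>?B. \<forall>p'\<in>?B. \<forall>q\<in>?B. \<forall>q'\<in>?B.
        nrm (p - q) \<le> \<delta> \<longrightarrow> nrm (p' - q') \<le> \<delta> \<longrightarrow>
        nrm (f h p - f h p' - (f 0 q - f 0 q')) \<le> K * nrm (p - p' - (q - q')) + \<epsilon> * nrm (p - p')"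
      by blast
  qed
  have f_lip: "nrm (f h p - f h q) \<le> K * nrm (p - q)" if "h \<in> {0..h0}" "nrm p < R" "nrm q < R" for h p q
  proof -
    have "f h p - f h q = blinfun_apply L (p - q) + (N h p - N h q)" by (simp add: f_def blinfun.diff_right)
    then have "nrm (f h p - f h q) \<le> \<Lambda> * nrm (p - q) + g * nrm (p - q)"
      using triangle[of "blinfun_apply L (p - q)" "N h p - N h q"] \<Lambda>(2)[of "p - q"] N_lip[OF that] by simp
    then show ?thesis unfolding K_def using nrm_nonneg[of "p - q"] by (simp add: distrib_right del: nrm_nonneg)
  qed
  have f0: "f h 0 = 0" if "h \<in> {0..h0}" for h by (simp add: f_def N0[OF that])
  have u_small: "nrm (u h k) < r" if "h \<in> {0..h0}" "k \<in> ?V" for h k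
    using unstable.orbit_0[OF \<kappa> r(1) unstable_contracting[OF that(1)], of k]
      unstable.orbit(2)[OF \<kappa> r(1) unstable_contracting[OF that(1)], of k 0] that(2)
    by (simp add: u_def unstable_map_def)
  have pow: "K ^ j * r \<le> R" if "j \<le> n" for j
    using mult_right_mono[OF power_increasing[OF that K] less_imp_le[OF r(1)]] small[folded K_def]
    by (rule order_trans)
  have bound: "nrm ((f h ^^ j) (u h k)) \<le> K ^ j * nrm (u h k) \<and> nrm ((f h ^^ j) (u h k)) < R"
    if "j \<le> n" "h \<in> {0..h0}" "k \<in> ?V" for j h k
    using that(1)
  proof (induction j)
    case 0
    then show ?case using u_small[OF that(2,3)] r by simp
  next
    case (Suc j)
    then have IH: "nrm ((f h ^^ j) (u h k)) \<le> K ^ j * nrm (u h k)" "nrm ((f h ^^ j) (u h k)) < R" by simp_all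
    have "nrm ((f h ^^ Suc j) (u h k)) \<le> K * nrm ((f h ^^ j) (u h k))"
      using f_lip[OF that(2) IH(2), of 0] R by (simp add: f0[OF that(2)])
    also have "\<dots> \<le> K * (K ^ j * nrm (u h k))" using IH K by (intro mult_left_mono) auto
    finally have le: "nrm ((f h ^^ Suc j) (u h k)) \<le> K ^ Suc j * nrm (u h k)" by (simp add: mult.assoc)
    also have "\<dots> < K ^ Suc j * r" using u_small[OF that(2,3)] K by (intro mult_strict_left_mono) auto
    also have "\<dots> \<le> R" by (rule pow[OF Suc.prems])
    finally show ?case using le by simp
  qed
  have zero: "0 \<in> {0..h0}" using h0 by simp
  have lip: "nrm ((f 0 ^^ j) (u 0 k) - (f 0 ^^ j) (u 0 k')) \<le> (2 * K ^ j) * nrm (k - k')"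
    if "j \<le> n" "k \<in> ?V" "k' \<in> ?V" for j k k'
    using that(1)
  proof (induction j)
    case 0
    have "u 0 k - u 0 k' = (k - k') + (unstable_map 0 k - unstable_map 0 k')" by (simp add: u_def)
    then show ?case
      using triangle[of "k - k'" "unstable_map 0 k - unstable_map 0 k'"] unstable_map_lipschitz[OF zero, of k k'] that
      by simp
  next
    case (Suc j)
    have "nrm ((f 0 ^^ Suc j) (u 0 k) - (f 0 ^^ Suc j) (u 0 k')) \<le> K * nrm ((f 0 ^^ j) (u 0 k) - (f 0 ^^ j) (u 0 k'))"
      using f_lip[OF zero] bound[OF _ zero that(2), of j] bound[OF _ zero that(3), of j] Suc.prems by simp
    also have "\<dots> \<le> K * (2 * K ^ j * nrm (k - k'))" using Suc K by (intro mult_left_mono) auto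
    finally show ?case by (simp add: mult_ac)
  qed
  have near_0: "\<forall>\<^sub>F h in at_right 0. h \<in> {0..h0}"
    by (rule eventually_at_right_0_Icc[OF h0])
  have "lip_tendsto ?V (\<lambda>h k. (f h ^^ j) (u h k))" if "j \<le> n" for j
    using that
  proof (induction j)
    case 0
    show ?case using unstable_map_tendsto by (simp add: lip_tendsto_def u_def)
  next
    case (Suc j)
    have "lip_tendsto ?V (\<lambda>h k. f h ((f h ^^ j) (u h k)))"
    proof (rule lip_tendsto_compose[OF f_regular, where M = "2 * K ^ j"])
      show "lip_tendsto ?V (\<lambda>h k. (f h ^^ j) (u h k))" using Suc by simp
      show "\<forall>\<^sub>F h in at_right 0. \<forall>k\<in>?V. (f h ^^ j) (u h k) \<in> ?B"
        using near_0 by (rule eventually_mono) (use bound[of j] Suc.prems in auto)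
      show "(f 0 ^^ j) (u 0 k) \<in> ?B" if "k \<in> ?V" for k using bound[OF _ zero that, of j] Suc.prems by simp
      show "nrm (f 0 p - f 0 q) \<le> K * nrm (p - q)" if "p \<in> ?B" "q \<in> ?B" for p q using f_lip[OF zero] that by simp
      show "nrm ((f 0 ^^ j) (u 0 k) - (f 0 ^^ j) (u 0 k')) \<le> 2 * K ^ j * nrm (k - k')" if "k \<in> ?V" "k' \<in> ?V" for k k'
        using lip[OF _ that] Suc.prems by simp
    qed (use K in auto)
    then show ?case by simp
  qed
  from this[of n] show ?thesis by (simp add: u_def)
qed

end

end

section \<open>Continuity of the local manifolds\<close>

lemma mem_translate_iff: "y \<in> (+) c ` B \<longleftrightarrow> y - c \<in> B" for c :: "'a::ab_group_add"
  by (force simp: image_iff)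

lemma local_stable_shift:
  "local_stable T x0 e ((+) x0 ` B) = (+) x0 ` local_stable (\<lambda>z. T (z + x0) - x0) 0 e B"
proof -
  have iter: "((\<lambda>z. T (z + x0) - x0) ^^ n) z = (T ^^ n) (x0 + z) - x0" for n z
    by (induction n) auto
  note mem = mem_translate_iff[of _ x0 B]
  show ?thesis
  proof (intro equalityI subsetI)
    fix y assume "y \<in> local_stable T x0 e ((+) x0 ` B)"
    then have "y - x0 \<in> local_stable (\<lambda>z. T (z + x0) - x0) 0 e B"
      by (simp add: local_stable_def iter mem)
    then show "y \<in> (+) x0 ` local_stable (\<lambda>z. T (z + x0) - x0) 0 e B" by (force simp: image_iff)
  next
    fix y assume "y \<in> (+) x0 ` local_stable (\<lambda>z. T (z + x0) - x0) 0 e B"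
    then obtain w where w: "y = x0 + w" "w \<in> local_stable (\<lambda>z. T (z + x0) - x0) 0 e B" by auto
    then show "y \<in> local_stable T x0 e ((+) x0 ` B)"
      by (simp add: local_stable_def iter mem)
  qed
qed

lemma local_unstable_shift:
  "local_unstable T x0 e ((+) x0 ` B) = (+) x0 ` local_unstable (\<lambda>z. T (z + x0) - x0) 0 e B" (is "?l = ?r")
proof -
  note mem = mem_translate_iff[of _ x0 B]
  show ?thesis
  proof (intro equalityI subsetI)
    fix z assume "z \<in> ?l"
    then obtain y where y: "z - x0 \<in> B" "y 0 = z" "\<And>j. y j - x0 \<in> B" "\<And>j. y j = T (y (Suc j))" 
      "bdd_above (range (\<lambda>j::nat. (1 + e) ^ j * norm (y j - x0)))" 
      unfolding local_unstable_def mem by blast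
    have "z - x0 \<in> local_unstable (\<lambda>z. T (z + x0) - x0) 0 e B"
      unfolding local_unstable_def
    proof (intro CollectI conjI exI[of _ "\<lambda>j. y j - x0"] allI)
      show "y j - x0 = T (y (Suc j) - x0 + x0) - x0" for j using y(4)[of j] by simp
    qed (use y(1,2,3,5) in \<open>simp_all add: mem\<close>)
    then show "z \<in> ?r" by (force simp: image_iff)
  next
    fix z assume "z \<in> ?r"
    then obtain w where w: "z = x0 + w" "w \<in> local_unstable (\<lambda>z. T (z + x0) - x0) 0 e B" by auto
    then obtain y where y: "w \<in> B" "y 0 = w" "\<And>j. y j \<in> B" "\<And>j. y j = T (y (Suc j) + x0) - x0" 
      "bdd_above (range (\<lambda>j::nat. (1 + e) ^ j * norm (y j - 0)))" 
      unfolding local_unstable_def by blast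
    show "z \<in> ?l"
      unfolding local_unstable_def
    proof (intro CollectI conjI exI[of _ "\<lambda>j. x0 + y j"] allI)
      show "x0 + y j = T (x0 + y (Suc j))" for j
        by (subst y(4)[of j]) (simp add: add.commute)
    qed (use y(1,2,3,5) w(1) in simp_all)
  qed
qed

theorem theorem5p4:
  fixes T :: "real \<Rightarrow> 'a::banach \<Rightarrow> 'a"
    and x :: "nat \<Rightarrow> real \<Rightarrow> 'a"
    and p :: nat
    and U :: "'a set"
  assumes cont: "\<And>\<eta>. \<eta> \<in> {0..1} \<Longrightarrow> continuous_on UNIV (T \<eta>)"
    and hyp: "\<And>\<eta> i. \<eta> \<in> {0..1} \<Longrightarrow> i \<in> {1..p} \<Longrightarrow> LL_hyperbolic (T \<eta>) (x i \<eta>)"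
    and eq_lim: "\<And>i. i \<in> {1..p} \<Longrightarrow> ((\<lambda>\<eta>. norm (x i \<eta> - x i 0)) \<longlongrightarrow> 0) (at_right 0)"
    and U: "open U" "(\<lambda>i. x i 0) ` {1..p} \<subseteq> U"
    and T_lim: "((\<lambda>\<eta>. lip_norm_on U (\<lambda>y. T \<eta> y - T 0 y)) \<longlongrightarrow> 0) (at_right 0)"
    and T_bilip: "\<And>\<eta>. \<eta> \<in> {0..1} \<Longrightarrow> bi_lipschitz U (T \<eta> ` U) (T \<eta>)"
    and T0: "C1_plus (T 0) ((\<lambda>i. x i 0) ` {1..p})"
  shows "\<forall>n. \<forall>i\<in>{1..p}. \<forall>L. LL_hyperbolic_with (T 0) (x i 0) L \<longrightarrow>
    (\<exists>e Ob. (\<forall>\<eta>\<in>{0..1}. local_data (x i \<eta>) (e \<eta>) (Ob \<eta>)) \<and>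
       unstable_family_continuous n L T (x i) e Ob \<and>
       stable_family_continuous L T (x i) e Ob)"
proof (intro allI ballI impI)
  fix n i L assume i: "i \<in> {1..p}" and "LL_hyperbolic_with (T 0) (x i 0) L"
  then obtain N0 a b nrm g where wh: "weakly_hyperbolic_with (T 0) (x i 0) L N0 a b nrm g"
    unfolding LL_hyperbolic_with_def by blast
  then interpret hyperbolic L a b nrm
    by unfold_locales (simp add: weakly_hyperbolic_with_def)
  define N where "N h z = T h (z + x i h) - x i h - blinfun_apply L z" for h z
  have fixed: "T h (x i h) = x i h" if "h \<in> {0..1}" for h
    using hyp[OF that i] by (auto simp: LL_hyperbolic_def LL_hyperbolic_with_def weakly_hyperbolic_with_def)
  have "N 0 = N0"
  proof
    fix z
    have "T 0 (z + x i 0) - x i 0 = blinfun_apply L z + N0 z" 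
      using wh by (simp add: weakly_hyperbolic_with_def)
    then show "N 0 z = N0 z" by (simp add: N_def)
  qed
  then obtain U0 where U0: "open U0" "0 \<in> U0" "\<And>z w. z \<in> U0 \<Longrightarrow> w \<in> U0 \<Longrightarrow> nrm (N 0 z - N 0 w) \<le> g * nrm (z - w)"
    using wh unfolding weakly_hyperbolic_with_def by blast
  have g: "0 < g" "b + 2 * g < 1" "1 + 2 * g < a" using wh by (auto simp: weakly_hyperbolic_with_def)
  obtain D W where D: "\<And>y. (T 0 has_derivative blinfun_apply (D y)) (at y)"
    and W: "open W" "(\<lambda>i. x i 0) ` {1..p} \<subseteq> W" "uniformly_continuous_on W D"
    using T0 unfolding C1_plus_def by blast
  have x_in: "x i 0 \<in> U \<inter> W" using U(2) W(2) i by blast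
  obtain \<rho>1 where \<rho>1: "0 < \<rho>1" "\<And>y. nrm (y - x i 0) < \<rho>1 \<Longrightarrow> y \<in> U \<inter> W"
    using nrm_ball_in_open[of "U \<inter> W" "x i 0"] U(1) W(1) x_in by blast
  obtain \<rho>2 where \<rho>2: "0 < \<rho>2" "\<And>y. nrm (y - 0) < \<rho>2 \<Longrightarrow> y \<in> U0"
    using nrm_ball_in_open[OF U0(1,2)] by blast
  define R where "R = min \<rho>1 \<rho>2 / 3"
  have R: "0 < R" using \<rho>1 \<rho>2 by (simp add: R_def)
  have ball: "x i 0 + z \<in> U" "x i 0 + z \<in> W" "z \<in> U0" if "nrm z < 3 * R" for z
    using \<rho>1(2)[of "x i 0 + z"] \<rho>2(2)[of z] that by (auto simp: R_def)
  have lip0: "nrm (N 0 z - N 0 w) \<le> g * nrm (z - w)" if "nrm z < 3 * R" "nrm w < 3 * R" for z w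
    using U0(3) ball that by blast
  have N_regular: "regular_family nrm {z. nrm z < R} g N"
    unfolding N_def
    by (rule regular_shifted_family[OF eq_lim[OF i] T_lim D W(3) ball(1,2) R])
       (use g lip0 in \<open>simp_all add: N_def\<close>)
  have "\<forall>\<^sub>F h in at_right 0. \<forall>p\<in>{z. nrm z < R}. \<forall>q\<in>{z. nrm z < R}. nrm (N h p - N h q) \<le> (2 * g) * nrm (p - q)"
    by (rule regular_family_lipschitz[OF N_regular]) (use g lip0 R in auto)
  then obtain h1 where h1: "0 < h1" "\<And>h p q. 0 < h \<Longrightarrow> h < h1 \<Longrightarrow> nrm p < R \<Longrightarrow> nrm q < R \<Longrightarrow>
      nrm (N h p - N h q) \<le> (2 * g) * nrm (p - q)"
    unfolding eventually_at_right_field by auto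
  define h0 where "h0 = min 1 (h1 / 2)"
  have h0_bounds: "0 < h0" "h0 \<le> 1" "h0 < h1" using h1(1) by (auto simp: h0_def)
  \<comment> \<open>weak hyperbolicity leaves room for doubling \<open>g\<close>, which makes the Lipschitz bound hold for all
    small parameters\<close>
  interpret hyperbolic_family L a b nrm N "2 * g" R h0
  proof unfold_locales
    fix h assume h: "h \<in> {0..h0}"
    show "N h 0 = 0" using fixed[of h] h h0_bounds by (simp add: N_def)
    fix z w assume zw: "nrm z < R" "nrm w < R"
    show "nrm (N h z - N h w) \<le> 2 * g * nrm (z - w)"
    proof (cases "h = 0")
      case True
      have "nrm (N 0 z - N 0 w) \<le> g * nrm (z - w)" using lip0[of z w] zw R by simp
      also have "\<dots> \<le> 2 * g * nrm (z - w)" using g(1) by (intro mult_right_mono) auto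
      finally show ?thesis using True by simp
    qed (use h h0_bounds h1(2) zw in auto)
  next
    show "regular_family nrm {z. nrm z < R} (2 * g) N"
      by (rule regular_family_mono[OF N_regular]) (use g in simp)
  qed (use g R h0_bounds in auto)
  have f: "f h = (\<lambda>z. T h (z + x i h) - x i h)" for h by (simp add: f_def N_def fun_eq_iff)
  obtain \<Lambda> where \<Lambda>: "0 \<le> \<Lambda>" "\<And>x. nrm (blinfun_apply L x) \<le> \<Lambda> * nrm x"
    using blinfun_nrm_bound by blast
  define r where "r = R / (1 + \<Lambda> + 2 * g) ^ n"
  have K: "1 \<le> 1 + \<Lambda> + 2 * g" using \<Lambda> g by simp
  have Kn: "1 \<le> (1 + \<Lambda> + 2 * g) ^ n" by (rule one_le_power[OF K])
  have r: "0 < r" "r \<le> R" and small: "(1 + \<Lambda> + 2 * g) ^ n * r \<le> R"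
    using Kn R by (simp_all add: r_def divide_le_eq mult_le_cancel_left1)
  \<comment> \<open>the same adapted ball for both manifolds\<close>
  define Ob where "Ob h = (+) (x i h) ` {z. nrm z < r}" for h
  have Ob_ball: "Ob h = {y. nrm (y - x i h) < r}" for h
    by (simp add: Ob_def set_eq_iff mem_translate_iff)
  let ?Vs = "{m \<in> Ss. nrm m < r}" and ?Vu = "{k \<in> Su. nrm k < r}"
  have open_V: "openin (top_of_set Ss) ?Vs" "openin (top_of_set Su) ?Vu"
  proof -
    have "?Vs = Ss \<inter> {y. nrm (y - 0) < r}" "?Vu = Su \<inter> {y. nrm (y - 0) < r}" by auto
    then show "openin (top_of_set Ss) ?Vs" "openin (top_of_set Su) ?Vu"
      using openin_open_Int[OF open_nrm_ball] by metis+
  qed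
  have zero_V: "0 \<in> ?Vs" "0 \<in> ?Vu" 
    using r subspace_0[OF subspace_Ss] subspace_0[OF subspace_Su] by simp_all
  have iterate: "(T h ^^ n) (x i h + z) = x i h + (f h ^^ n) z" for h z
    by (induction n) (simp_all add: f add.commute)
  have stable: "stable_family_continuous L T (x i) (\<lambda>_. rate) Ob"
    unfolding stable_family_continuous_def
  proof (rule exI[of _ ?Vs], rule exI[of _ "stable_map r"], intro conjI open_V zero_V,
      rule exI[of _ h0], intro conjI h0_bounds ballI)
    fix h assume h: "h \<in> {0..h0}"
    show "stable_map r h ` ?Vs \<subseteq> Su" using stable_map_in[OF r h] by blast
    show "\<exists>C. C-lipschitz_on ?Vs (stable_map r h)"
      by (rule lipschitz_on_of_nrm[where M = 1]) (use stable_map_lipschitz[OF r h] in auto)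
    show "local_stable (T h) (x i h) rate (Ob h) = (\<lambda>m. x i h + stable_map r h m + m) ` ?Vs"
      unfolding Ob_def local_stable_shift f[symmetric] local_stable_graph[OF r h] 
      by (simp add: image_image add.assoc)
  next
    show "((\<lambda>h. lip_norm_on ?Vs (\<lambda>m. stable_map r h m - stable_map r 0 m)) \<longlongrightarrow> 0) (at_right 0)"
      using stable_map_tendsto[OF r] by (simp add: lip_tendsto_iff_lip_norm)
  qed
  have unstable: "unstable_family_continuous n L T (x i) (\<lambda>_. rate) Ob"
    unfolding unstable_family_continuous_def
  proof (rule exI[of _ ?Vu], rule exI[of _ "unstable_map r"], intro conjI open_V zero_V,
      rule exI[of _ h0], intro conjI h0_bounds ballI)
    fix h assume h: "h \<in> {0..h0}"
    show "unstable_map r h ` ?Vu \<subseteq> Ss" using unstable_map_in[OF r h] by blast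
    show "\<exists>C. C-lipschitz_on ?Vu (unstable_map r h)"
      by (rule lipschitz_on_of_nrm[where M = 1]) (use unstable_map_lipschitz[OF r h] in auto)
    show "local_unstable (T h) (x i h) rate (Ob h) = (\<lambda>k. x i h + k + unstable_map r h k) ` ?Vu"
      unfolding Ob_def local_unstable_shift f[symmetric] local_unstable_graph[OF r h] 
      by (simp add: image_image add.assoc)
  next
    show "((\<lambda>h. lip_norm_on ?Vu (\<lambda>m. unstable_map r h m - unstable_map r 0 m)) \<longlongrightarrow> 0) (at_right 0)"
      using unstable_map_tendsto[OF r] by (simp add: lip_tendsto_iff_lip_norm)
    have "lip_tendsto ?Vu (\<lambda>h k. x i h + (f h ^^ n) (k + unstable_map r h k))"
      by (rule lip_tendsto_add_const[OF eq_lim[OF i] iterated_unstable_tendsto[OF r \<Lambda> small]])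
    then show "((\<lambda>h. lip_norm_on ?Vu (\<lambda>k. (T h ^^ n) (x i h + k + unstable_map r h k) 
        - (T 0 ^^ n) (x i 0 + k + unstable_map r 0 k))) \<longlongrightarrow> 0) (at_right 0)"
      by (simp add: lip_tendsto_iff_lip_norm iterate add.assoc)
  qed
  have "local_data (x i h) rate (Ob h)" for h
    unfolding local_data_def using rate r open_nrm_ball[of "x i h" r] by (simp add: Ob_ball)
  then show "\<exists>e Ob. (\<forall>\<eta>\<in>{0..1}. local_data (x i \<eta>) (e \<eta>) (Ob \<eta>)) \<and>
       unstable_family_continuous n L T (x i) e Ob \<and> stable_family_continuous L T (x i) e Ob"
    using stable unstable by (intro exI[of _ "\<lambda>_. rate"] exI[of _ Ob] conjI ballI)
qed

end
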